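(* Let $Q\in\mathbb{Q}^{n\times n}$ be an arbitrary matrix and let $q,\underline{x},\overline{x}\in\mathbb{Q}^n$ with $\underline{x}\le\overline{x}$ (componentwise). Then the algorithm "Algorithm 1" described in the context is correct and solves the problem $$\max_{x\in\mathbb{R}^n}\ x^{\mathrm T}Qx+q^{\mathrm T}x\quad\text{s.t.}\quad \underline{x}\le x\le\overline{x}.$$ That is, the returned value $f^*$ equals the maximum, and the returned $x^*$ (if $q=0$), respectively the vector of the first $n$ entries of the returned $x^*$ (if $q\neq0$), is a maximizer.
   Context: Algorithm 1. Input: $Q\in\mathbb{Q}^{n\times n}$, $q,\underline{x},\overline{x}\in\mathbb{Q}^n$. (1) Set $f^*:=-\infty$, $x^*:=0$. (2) If $q\ne 0$, replace $Q$ by $\begin{pmatrix}Q&\frac12 q\\ \frac12 q^{\mathrm T}&0\end{pmatrix}$, $\underline{x}$ by $\binom{\underline{x}}{1}$ and $\overline{x}$ by $\binom{\overline{x}}{1}$. In the following steps let $N$ be the order and $\rho$ the rank of the current matrix $Q$. (3) Compute $U,V\in\mathbb{Q}^{\rho\times N}$ with $U^{\mathrm T}V=Q$, and let $G:=\binom{U}{V}\in\mathbb{Q}^{2\rho\times N}$ with columns $g_1,\dots,g_N$. Let $W:=\frac12\begin{pmatrix}0&I_\rho\\ I_\rho&0\end{pmatrix}$. (4) Compute the set $S$ of sign vectors of regions of the central arrangement of the hyperplanes $g_i^{\mathrm T}y=0$, $i=1,\dots,N$, in $\mathbb{R}^{2\rho}$. The sign vector $\sigma(y)\in\{-1,0,1\}^N$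 of $y\in\mathbb{R}^{2\rho}$ has $\sigma_i(y)$ equal to the sign of $g_i^{\mathrm T}y$; a region is the set of all points with the same sign vector (so regions of all dimensions are included), and $S=\{\sigma(y): y\in\mathbb{R}^{2\rho}\}$. (5) For each $\sigma\in S$ do the following. Reorder coordinates so that the zero entries of $\sigma$ come first, say there are $k$ of them, and split accordingly $G=(G_A,G_b)$, $\underline{x}=\binom{\underline{x}_A}{\underline{x}_b}$, $\overline{x}=\binom{\overline{x}_A}{\overline{x}_b}$, $\sigma=\binom{\sigma_A}{\sigma_b}$. Compute a matrix $A\in\mathbb{Q}^{\ell\times 2\rho}$, $\ell=2\rho-\operatorname{rank}(G_A)$, whose rows form a basis of the orthogonal complement of the column space of $G_A$. Put $x_b:=\frac12(\underline{x}_b+\overline{x}_b)+\frac12\operatorname{diag}(\sigma_b)(\overline{x}_b-\underline{x}_b)$ and $b:=G_bx_b$. (The set $\{y: Ay=Ab\}$ is constructed as the affine hull of the face $\{Gx:\underline{x}\le x\le\overline{x},\ x_i=\overline{x}_i\text{ if }\sigma_i=1,\ x_i=\underline{x}_i\text{ if }\sigma_i=-1\}$ of the zonotope $\{Gx:\underline{x}\le x\le\overline{x}\}$.) Find any solution of the linear system $$A^{\mathrm T}\lambda-2WG_Ax_A=2Wb,\qquad \underline{x}_A\le x_A\le\overline{x}_A$$ in the variables $x_A\in\mathbb{R}^k$, $\lambda\in\mathbb{R}^\ell$ (a linear program). If it is infeasible, proceed to the next $\sigma$. Otherwise let $x=\binom{x_A}{x_b}$ (in the original order of coordinates); if $x^{\mathrm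 T}Qx>f^*$, set $x^*:=x$ and $f^*:=x^{\mathrm T}Qx$. (6) Return $f^*$ and $x^*$. *)

theory Defs
  imports "Jordan_Normal_Form.DL_Rank" "HOL-Library.Extended_Real"
begin

text \<open>Everything lives over the reals; a rational vector or matrix is a real one all of whose
  entries lie in \<open>\<rat>\<close>.\<close>

definition box :: "nat \<Rightarrow> real vec \<Rightarrow> real vec \<Rightarrow> real vec set" where
  "box n l u = {x \<in> carrier_vec n. l \<le> x \<and> x \<le> u}"

definition quad_objective :: "real mat \<Rightarrow> real vec \<Rightarrow> real vec \<Rightarrow> real" where
  "quad_objective Q q x = x \<bullet> (Q *\<^sub>v x) + q \<bullet> x"

text \<open>The linear term is absorbed into the matrix by an extra coordinate fixed to 1.\<close>

definition homogenize :: "real mat \<Rightarrow> real vec \<Rightarrow> real mat" where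
  "homogenize Q q = (let n = dim_vec q in
     if q = 0\<^sub>v n then Q
     else four_block_mat Q (mat_of_cols n [(1/2) \<cdot>\<^sub>v q]) (mat_of_rows n [(1/2) \<cdot>\<^sub>v q]) (0\<^sub>m 1 1))"

definition extend_bound :: "real vec \<Rightarrow> real vec \<Rightarrow> real vec" where
  "extend_bound q v = (if q = 0\<^sub>v (dim_vec q) then v else v @\<^sub>v vec_of_list [1])"

definition W_mat :: "nat \<Rightarrow> real mat" where
  "W_mat r = (1/2) \<cdot>\<^sub>m four_block_mat (0\<^sub>m r r) (1\<^sub>m r) (1\<^sub>m r) (0\<^sub>m r r)"

definition sign_vec :: "real mat \<Rightarrow> real vec \<Rightarrow> real vec" where
  "sign_vec G y = vec (dim_col G) (\<lambda>i. sgn (col G i \<bullet> y))"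

definition sign_vecs :: "real mat \<Rightarrow> real vec set" where
  "sign_vecs G = sign_vec G ` carrier_vec (dim_row G)"

text \<open>Reordering the coordinates so that the zero entries of a sign vector come first is expressed by the increasing lists of zero and of nonzero
  positions of the sign vector; \<open>subvec\<close> and \<open>subcols\<close> extract the corresponding parts
  (index A: \<open>zero_pos \<sigma>\<close>, index b: \<open>nonzero_pos \<sigma>\<close>).\<close>

definition zero_pos :: "real vec \<Rightarrow> nat list" where
  "zero_pos \<sigma> = filter (\<lambda>i. \<sigma> $ i = 0) [0..<dim_vec \<sigma>]"

definition nonzero_pos :: "real vec \<Rightarrow> nat list" where
  "nonzero_pos \<sigma> = filter (\<lambda>i. \<sigma> $ i \<noteq> 0) [0..<dim_vec \<sigma>]"

definition subvec :: "nat list \<Rightarrow> real vec \<Rightarrow> real vec" where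
  "subvec is v = vec_of_list (map (\<lambda>i. v $ i) is)"

definition subcols :: "nat list \<Rightarrow> real mat \<Rightarrow> real mat" where
  "subcols is M = mat_of_cols (dim_row M) (map (col M) is)"

text \<open>\<open>A\<close> is an admissible choice of the rational matrix whose rows form a basis of the orthogonal
  complement of the column space of \<open>M\<close>.\<close>

definition complement_basis_mat :: "real mat \<Rightarrow> real mat \<Rightarrow> bool" where
  "complement_basis_mat M A \<longleftrightarrow> (let d = dim_row M;
       C = vec_module.orthogonal_complement d (vec_space.col_space d M) in
     A \<in> carrier_mat (d - vec_space.rank d M) d \<and> elements_mat A \<subseteq> \<rat> \<and>
     distinct (rows A) \<and>
     vectorspace.basis class_ring (module_vec TYPE(real) d \<lparr>carrier := C\<rparr>) (set (rows A)))"

definition fixed_part :: "real vec \<Rightarrow> real vec \<Rightarrow> real vec \<Rightarrow> real vec" where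
  "fixed_part \<sigma> l u = (let bs = nonzero_pos \<sigma>; l\<^sub>b = subvec bs l; u\<^sub>b = subvec bs u;
       \<sigma>\<^sub>b = subvec bs \<sigma> in
     (1/2) \<cdot>\<^sub>v (l\<^sub>b + u\<^sub>b) +
     (1/2) \<cdot>\<^sub>v (mat_diag (dim_vec \<sigma>\<^sub>b) (\<lambda>i. \<sigma>\<^sub>b $ i) *\<^sub>v (u\<^sub>b - l\<^sub>b)))"

definition lp_solution ::
  "real mat \<Rightarrow> real mat \<Rightarrow> real mat \<Rightarrow> real vec \<Rightarrow> real vec \<Rightarrow> real vec \<Rightarrow> real vec \<Rightarrow> real vec \<Rightarrow> bool"
where
  "lp_solution A W G\<^sub>A b l\<^sub>A u\<^sub>A lam x\<^sub>A \<longleftrightarrow>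
     lam \<in> carrier_vec (dim_row A) \<and> x\<^sub>A \<in> box (dim_col G\<^sub>A) l\<^sub>A u\<^sub>A \<and>
     transpose_mat A *\<^sub>v lam - (2 \<cdot>\<^sub>m W * G\<^sub>A) *\<^sub>v x\<^sub>A = (2 \<cdot>\<^sub>m W) *\<^sub>v b"

text \<open>All vectors \<open>x\<close>, in the original order of coordinates, that can be assembled from a solution
  of the linear program for the sign vector \<open>\<sigma>\<close> and the chosen matrix \<open>A\<close>.\<close>

definition candidates ::
  "nat \<Rightarrow> real mat \<Rightarrow> real vec \<Rightarrow> real vec \<Rightarrow> real vec \<Rightarrow> real mat \<Rightarrow> real vec set" where
  "candidates \<rho> G l u \<sigma> A =
     (let as = zero_pos \<sigma>; bs = nonzero_pos \<sigma>; x\<^sub>b = fixed_part \<sigma> l u; b = subcols bs G *\<^sub>v x\<^sub>b in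
      {x \<in> carrier_vec (dim_col G). subvec bs x = x\<^sub>b \<and>
         (\<exists>lam. lp_solution A (W_mat \<rho>) (subcols as G) b (subvec as l) (subvec as u)
                 lam (subvec as x))})"

definition update :: "real mat \<Rightarrow> real vec \<Rightarrow> ereal \<times> real vec \<Rightarrow> ereal \<times> real vec" where
  "update Q x = (\<lambda>(f, x'). if ereal (x \<bullet> (Q *\<^sub>v x)) > f then (ereal (x \<bullet> (Q *\<^sub>v x)), x) else (f, x'))"

text \<open>The choices of \<open>U\<close>, \<open>V\<close>, of the matrices \<open>A\<close>, of the solutions of the linear programs and of
  the order in which the sign vectors are processed are left open by the algorithm, so it is modelled
  as a relation between inputs and possible outputs. The pairs are \<open>(f\<^sup>*, x\<^sup>*)\<close>.\<close>

definition process_sign ::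
  "nat \<Rightarrow> real mat \<Rightarrow> real mat \<Rightarrow> real vec \<Rightarrow> real vec \<Rightarrow> real vec \<Rightarrow>
   ereal \<times> real vec \<Rightarrow> ereal \<times> real vec \<Rightarrow> bool" where
  "process_sign \<rho> Q G l u \<sigma> s s' \<longleftrightarrow>
     (\<exists>A. complement_basis_mat (subcols (zero_pos \<sigma>) G) A \<and>
          (if candidates \<rho> G l u \<sigma> A = {} then s' = s
           else \<exists>x \<in> candidates \<rho> G l u \<sigma> A. s' = update Q x s))"

inductive process_signs ::
  "nat \<Rightarrow> real mat \<Rightarrow> real mat \<Rightarrow> real vec \<Rightarrow> real vec \<Rightarrow> real vec list \<Rightarrow>
   ereal \<times> real vec \<Rightarrow> ereal \<times> real vec \<Rightarrow> bool"
  for \<rho> Q G l u where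
  nil: "process_signs \<rho> Q G l u [] s s"
| cons: "process_sign \<rho> Q G l u \<sigma> s s' \<Longrightarrow> process_signs \<rho> Q G l u \<sigma>s s' s'' \<Longrightarrow>
         process_signs \<rho> Q G l u (\<sigma> # \<sigma>s) s s''"

definition algorithm1 ::
  "real mat \<Rightarrow> real vec \<Rightarrow> real vec \<Rightarrow> real vec \<Rightarrow> ereal \<times> real vec \<Rightarrow> bool" where
  "algorithm1 Q q l u result \<longleftrightarrow>
     (let Q' = homogenize Q q; l' = extend_bound q l; u' = extend_bound q u;
          N = dim_row Q'; \<rho> = vec_space.rank N Q' in
      \<exists>U V \<sigma>s.
        U \<in> carrier_mat \<rho> N \<and> V \<in> carrier_mat \<rho> N \<and> elements_mat U \<subseteq> \<rat> \<and> elements_mat V \<subseteq> \<rat> \<and>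
        transpose_mat U * V = Q' \<and>
        distinct \<sigma>s \<and> set \<sigma>s = sign_vecs (U @\<^sub>r V) \<and>
        process_signs \<rho> Q' (U @\<^sub>r V) l' u' \<sigma>s (-\<infinity>, 0\<^sub>v (dim_vec q)) result)"

end

theory Submission
  imports Defs "HOL-Analysis.Function_Topology"
begin

text \<open>Write \<open>G\<close> for \<open>U\<close> stacked on \<open>V\<close>, where \<open>Q = U\<^sup>T V\<close>, and \<open>y = G x\<close>. Then \<open>x \<bullet> Q x = y \<bullet> W y\<close>, so the gradient
of the objective in \<open>y\<close> is \<open>c = 2 W G x\<close>, and the partial derivatives in \<open>x\<close> are the numbers
\<open>g\<^sub>i \<bullet> c\<close> (\<open>col_scalar_prod_two_W\<close>). Let \<open>x\<close> be a maximizer over the box; it exists by compactness. The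
first-order conditions say that \<open>x\<close> sits at its upper bound where \<open>g\<^sub>i \<bullet> c > 0\<close>, at its lower bound
where \<open>g\<^sub>i \<bullet> c < 0\<close>, and that \<open>c\<close> is orthogonal to the remaining columns. These remaining columns are
exactly \<open>G\<^sub>A\<close> for the sign vector \<open>\<sigma>\<close> of the point \<open>c\<close>, and orthogonality to them means that
\<open>c = A\<^sup>T \<lambda>\<close> for some \<open>\<lambda>\<close>. So \<open>x\<close> solves the linear program of a sign vector that the algorithm visits
(\<open>box_maximizer_face_stationary\<close>, \<open>candidates_eq_face_stationary\<close>).

The algorithm may pick another solution \<open>x'\<close> of that program, but this is harmless: the difference
\<open>y' - y\<close> lies in the column space of \<open>G\<^sub>A\<close>, to which both gradients \<open>2 W y\<close> and \<open>2 W y'\<close> are orthogonal,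
and a quadratic form takes equal values at two such points (\<open>face_stationary_same_value\<close>). Since
every candidate is feasible, the largest value met along the way is the maximum, and it is recorded
together with a point that attains it (\<open>process_signs_maximizes\<close>).

The algorithm must also be able to run to its end, which means that rational choices for \<open>U\<close>, \<open>V\<close> and
every \<open>A\<close> exist although rank and orthogonality are taken over the reals. All of them are read off from
one construction (\<open>rational_adapted_basis\<close>): a maximal independent set of columns of a rational matrix
is completed by unit vectors to an invertible rational matrix \<open>P\<close>, whose inverse \<open>R\<close> is again rational.
The leading columns of \<open>P\<close> and rows of \<open>R M\<close> factorize \<open>M\<close>, and the trailing rows of \<open>R\<close> form a basis
of the orthogonal complement of its columns.

A linear term is the quadratic form of the bordered matrix at points whose last coordinate is 1, and
the box of the bordered problem contains only such points.\<close>

section \<open>Maximizers of quadratic forms over boxes\<close>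

text \<open>The gradient of \<open>x \<bullet> Q x\<close>; the matrix \<open>Q\<close> need not be symmetric.\<close>

definition gradient :: "real mat \<Rightarrow> real vec \<Rightarrow> real vec" where
  "gradient Q x = Q *\<^sub>v x + Q\<^sup>T *\<^sub>v x"

lemma gradient_carrier[simp]: "Q \<in> carrier_mat N N \<Longrightarrow> gradient Q x \<in> carrier_vec N"
  by (intro carrier_vecI) (auto simp: gradient_def)

lemma scalar_prod_gradient:
  assumes "Q \<in> carrier_mat N N" "x \<in> carrier_vec N" "z \<in> carrier_vec N"
  shows "z \<bullet> gradient Q x = z \<bullet> (Q *\<^sub>v x) + x \<bullet> (Q *\<^sub>v z)"
proof -
  have "z \<bullet> (Q\<^sup>T *\<^sub>v x) = (Q\<^sup>T *\<^sub>v x) \<bullet> z"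
    using assms by (intro comm_scalar_prod[of _ N]) auto
  also have "\<dots> = x \<bullet> (Q *\<^sub>v z)"
    using assms by (intro transpose_vec_mult_scalar[of _ N N]) auto
  finally show ?thesis
    using assms by (simp add: gradient_def scalar_prod_add_distrib[of _ N])
qed

lemma quadratic_form_add:
  assumes "Q \<in> carrier_mat N N" "x \<in> carrier_vec N" "z \<in> carrier_vec N"
  shows "(x + z) \<bullet> (Q *\<^sub>v (x + z)) =
    x \<bullet> (Q *\<^sub>v x) + z \<bullet> gradient Q x + z \<bullet> (Q *\<^sub>v z)"
proof -
  have "(x + z) \<bullet> (Q *\<^sub>v (x + z)) = x \<bullet> (Q *\<^sub>v (x + z)) + z \<bullet> (Q *\<^sub>v (x + z))"
    using assms by (intro add_scalar_prod_distrib[of _ N]) auto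
  moreover have "Q *\<^sub>v (x + z) = Q *\<^sub>v x + Q *\<^sub>v z"
    using assms by (intro mult_add_distrib_mat_vec) auto
  ultimately show ?thesis
    using assms scalar_prod_gradient[OF assms]
    by (simp add: scalar_prod_add_distrib[of _ N])
qed

lemma gradient_diff:
  assumes "Q \<in> carrier_mat N N" "x \<in> carrier_vec N" "z \<in> carrier_vec N"
  shows "gradient Q (x - z) = gradient Q x - gradient Q z"
proof -
  have "Q *\<^sub>v (x - z) = Q *\<^sub>v x - Q *\<^sub>v z" "Q\<^sup>T *\<^sub>v (x - z) = Q\<^sup>T *\<^sub>v x - Q\<^sup>T *\<^sub>v z"
    using assms by (auto intro!: mult_minus_distrib_mat_vec)
  then show ?thesis
    using assms by (intro eq_vecI) (auto simp: gradient_def)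
qed

text \<open>A vector is read as a function on the natural numbers that vanishes from \<open>N\<close> on. The box becomes a
product of compact intervals and points, which is compact by Tychonoff's theorem.\<close>

lemma quadratic_form_attains_max_on_box:
  assumes Q: "Q \<in> carrier_mat N N" and l: "l \<in> carrier_vec N" and lu: "l \<le> u"
  obtains x where "x \<in> box N l u"
    and "\<And>z. z \<in> box N l u \<Longrightarrow> z \<bullet> (Q *\<^sub>v z) \<le> x \<bullet> (Q *\<^sub>v x)"
proof -
  define K where "K = PiE UNIV (\<lambda>i. if i < N then {l $ i .. u $ i} else {0})"
  define F where "F = (\<lambda>f :: nat \<Rightarrow> real. \<Sum>i<N. f i * (\<Sum>j<N. Q $$ (i,j) * f j))"
  have u: "dim_vec u = N" and le: "\<And>i. i < N \<Longrightarrow> l $ i \<le> u $ i"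
    using l lu by (auto simp: less_eq_vec_def)
  have "compactin (product_topology (\<lambda>i. euclidean) UNIV) K"
    unfolding K_def compactin_PiE by auto
  then have "compact K"
    by (simp add: euclidean_product_topology)
  moreover have "(\<lambda>i. if i < N then l $ i else 0) \<in> K"
    using le by (auto simp: K_def)
  moreover have "continuous_on K F"
    unfolding F_def by (intro continuous_intros continuous_on_product_then_coordinatewise continuous_on_id)
  ultimately obtain f where f: "f \<in> K" and max: "\<And>g. g \<in> K \<Longrightarrow> F g \<le> F f"
    using continuous_attains_sup[of K F] by blast
  have F: "x \<bullet> (Q *\<^sub>v x) = F (\<lambda>i. if i < N then x $ i else 0)" if "x \<in> carrier_vec N" for x
    using that Q by (simp add: F_def scalar_prod_def lessThan_atLeast0)
  show thesis
  proof
    show "vec N f \<in> box N l u"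
      using f u l by (auto simp: K_def box_def less_eq_vec_def PiE_iff)
        (metis atLeastAtMost_iff)+
    fix z assume z: "z \<in> box N l u"
    then have zc: "z \<in> carrier_vec N" by (simp add: box_def)
    have "(\<lambda>i. if i < N then z $ i else 0) \<in> K"
      using z u by (auto simp: K_def box_def less_eq_vec_def)
    from max[OF this] have "z \<bullet> (Q *\<^sub>v z) \<le> F f" using F[OF zc] by simp
    also have "F f = vec N f \<bullet> (Q *\<^sub>v vec N f)"
      unfolding F[OF vec_carrier] by (simp add: F_def)
    finally show "z \<bullet> (Q *\<^sub>v z) \<le> vec N f \<bullet> (Q *\<^sub>v vec N f)" .
  qed
qed

text \<open>The condition that the linear program for \<open>\<sigma>\<close> encodes, freed from \<open>U\<close>, \<open>V\<close> and \<open>A\<close>: the signs select a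
face of the box, and the gradient vanishes along the coordinates that are free on this face.\<close>

definition face_stationary ::
  "real mat \<Rightarrow> real vec \<Rightarrow> real vec \<Rightarrow> real vec \<Rightarrow> real vec \<Rightarrow> bool" where
  "face_stationary Q l u \<sigma> x \<longleftrightarrow> x \<in> box (dim_vec \<sigma>) l u \<and>
     (\<forall>i<dim_vec \<sigma>. if \<sigma> $ i = 0 then gradient Q x $ i = 0
                  else x $ i = (if \<sigma> $ i > 0 then u $ i else l $ i))"

text \<open>For small \<open>t\<close> the linear term dominates, so a positive slope \<open>a\<close> would make the expression positive.\<close>

lemma nonpositive_slope:
  fixes a b e :: real
  assumes "\<And>t. 0 < t \<Longrightarrow> t \<le> e \<Longrightarrow> t * a + t\<^sup>2 * b \<le> 0" and e: "0 < e"
  shows "a \<le> 0"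
proof (rule ccontr)
  assume a: "\<not> a \<le> 0"
  \<comment> \<open>small enough for \<open>t * \<bar>b\<bar> < a\<close>\<close>
  define t where "t = min e (a / (2 * (\<bar>b\<bar> + 1)))"
  have t: "0 < t" "t \<le> e" using a e by (auto simp: t_def)
  have "t * \<bar>b\<bar> \<le> a / (2 * (\<bar>b\<bar> + 1)) * (\<bar>b\<bar> + 1)"
    using a by (intro mult_mono) (auto simp: t_def)
  also have "\<dots> < a" using a by (simp add: field_simps add_pos_nonneg)
  finally have "0 < a + t * b" 
    using abs_ge_minus_self[of "t * b"] t(1) by (simp add: abs_mult)
  then have "0 < t * (a + t * b)" using t by simp
  with assms(1)[OF t] show False by (simp add: algebra_simps power2_eq_square)
qed

text \<open>First-order conditions: from a maximizer, no coordinate direction that stays inside the box can have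
a positive directional derivative.\<close>

lemma box_maximizer_face_stationary:
  assumes Q: "Q \<in> carrier_mat N N" and l: "l \<in> carrier_vec N" and u: "u \<in> carrier_vec N"
    and x: "x \<in> box N l u"
    and max: "\<And>z. z \<in> box N l u \<Longrightarrow> z \<bullet> (Q *\<^sub>v z) \<le> x \<bullet> (Q *\<^sub>v x)"
  shows "face_stationary Q l u (vec N (\<lambda>i. sgn (gradient Q x $ i))) x"
proof -
  have xc: "x \<in> carrier_vec N" using x by (simp add: box_def)
  have bnd: "l $ i \<le> x $ i \<and> x $ i \<le> u $ i" if "i < N" for i
    using x that u xc unfolding box_def less_eq_vec_def by simp
  \<comment> \<open>\<open>s = 1\<close> and \<open>s = -1\<close> are the two directions along coordinate \<open>i\<close>; a step of length \<open>e\<close> stays in the box\<close>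
  have step: "s * gradient Q x $ i \<le> 0"
    if i: "i < N" and e: "0 < e" and "\<bar>s\<bar> = 1" and feas: "l $ i \<le> x $ i + s * e" "x $ i + s * e \<le> u $ i"
    for i e s
  proof (rule nonpositive_slope[OF _ e])
    fix t assume t: "0 < t" "t \<le> e"
    define z where "z = (s * t) \<cdot>\<^sub>v unit_vec N i"
    have z: "z \<in> carrier_vec N" by (simp add: z_def)
    have "l $ i \<le> x $ i + s * t \<and> x $ i + s * t \<le> u $ i"
      using that(3) feas bnd[OF i] t by (cases "0 \<le> s") (auto simp: abs_if split: if_splits)
    then have "x + z \<in> box N l u"
      using bnd xc l u i by (auto simp: box_def less_eq_vec_def z_def unit_vec_def)
    from max[OF this] have "z \<bullet> gradient Q x + z \<bullet> (Q *\<^sub>v z) \<le> 0"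
      using quadratic_form_add[OF Q xc z] by simp
    moreover have "z \<bullet> v = s * t * v $ i" if "v \<in> carrier_vec N" for v
      using that i by (simp add: z_def)
    moreover have "(Q *\<^sub>v z) $ i = s * t * Q $$ (i,i)"
      using Q i by (simp add: z_def)
    ultimately have "s * t * gradient Q x $ i + s * t * (s * t * Q $$ (i,i)) \<le> 0"
      using Q gradient_carrier[OF Q, of x] z by (metis mult_mat_vec_carrier)
    moreover have "s * t * (s * t * Q $$ (i,i)) = t\<^sup>2 * Q $$ (i,i)"
    proof -
      have "s * s = 1" using that(3) by (metis abs_mult_self_eq mult_1)
      then show ?thesis by (metis mult.assoc mult.commute mult_1 power2_eq_square)
    qed
    ultimately show "t * (s * gradient Q x $ i) + t\<^sup>2 * Q $$ (i,i) \<le> 0"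
      by (metis mult.assoc mult.commute)
  qed
  show ?thesis
    unfolding face_stationary_def
  proof (intro conjI allI impI)
    show "x \<in> box (dim_vec (vec N (\<lambda>i. sgn (gradient Q x $ i)))) l u" using x by simp
    fix i assume "i < dim_vec (vec N (\<lambda>i. sgn (gradient Q x $ i)))"
    then have i: "i < N" by simp
    have "x $ i = u $ i" if "gradient Q x $ i > 0"
      using step[OF i, of "u $ i - x $ i" 1] bnd[OF i] that by fastforce
    moreover have "x $ i = l $ i" if "gradient Q x $ i < 0"
      using step[OF i, of "x $ i - l $ i" "-1"] bnd[OF i] that by fastforce
    ultimately show "if vec N (\<lambda>i. sgn (gradient Q x $ i)) $ i = 0 then gradient Q x $ i = 0
       else x $ i = (if vec N (\<lambda>i. sgn (gradient Q x $ i)) $ i > 0 then u $ i else l $ i)"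
      using i by (auto simp: sgn_if)
  qed
qed

text \<open>Let \<open>z = x - y\<close>. It vanishes on the fixed coordinates and both gradients vanish on the free ones, so \<open>z\<close>
is orthogonal to both. The expansion at \<open>y\<close> has then no linear term, and its quadratic term is half
of \<open>z \<bullet> (gradient Q x - gradient Q y)\<close>, which is zero as well.\<close>

lemma face_stationary_same_value:
  assumes Q: "Q \<in> carrier_mat N N" and \<sigma>: "\<sigma> \<in> carrier_vec N"
    and x: "face_stationary Q l u \<sigma> x" and y: "face_stationary Q l u \<sigma> y"
  shows "x \<bullet> (Q *\<^sub>v x) = y \<bullet> (Q *\<^sub>v y)"
proof -
  have c: "x \<in> carrier_vec N" "y \<in> carrier_vec N"
    using x y \<sigma> by (auto simp: face_stationary_def box_def)
  define z where "z = x - y"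
  have z: "z \<in> carrier_vec N" using c by (simp add: z_def)
  have orth: "z \<bullet> gradient Q w = 0" if "face_stationary Q l u \<sigma> w" for w
    unfolding scalar_prod_def
  proof (intro sum.neutral ballI)
    fix i assume "i \<in> {0..<dim_vec (gradient Q w)}"
    then have i: "i < dim_vec \<sigma>" using gradient_carrier[OF Q, of w] \<sigma> by auto
    then show "z $ i * gradient Q w $ i = 0"
      using x y that c \<sigma> by (cases "\<sigma> $ i = 0") (auto simp: face_stationary_def z_def)
  qed
  have "2 * (z \<bullet> (Q *\<^sub>v z)) = z \<bullet> gradient Q z"
    using scalar_prod_gradient[OF Q z z] by simp
  also have "\<dots> = z \<bullet> gradient Q x - z \<bullet> gradient Q y"
    using c z unfolding z_def gradient_diff[OF Q c]
    by (intro scalar_prod_minus_distrib[of _ N]) (auto simp: Q)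
  also have "\<dots> = 0" using orth[OF x] orth[OF y] by simp
  finally have "z \<bullet> (Q *\<^sub>v z) = 0" by simp
  moreover have "x = y + z" using c by (auto simp: z_def)
  ultimately show ?thesis
    using quadratic_form_add[OF Q c(2) z] orth[OF y] by simp
qed

section \<open>The linear program of a sign vector\<close>

lemma (in vec_space) orthogonal_complement_submodule:
  "S \<subseteq> carrier_vec n \<Longrightarrow> LinearCombinations.submodule class_ring (orthogonal_complement S) V"
  unfolding submodule_def
  by (auto simp: orthogonal_complement_def add_scalar_prod_distrib[of _ n] subset_iff)
     (rule module_axioms)

lemma orthogonal_complement_col_space:
  fixes M :: "real mat"
  assumes "M \<in> carrier_mat d k"
  shows "vec_module.orthogonal_complement d (vec_space.col_space d M) =
    {y \<in> carrier_vec d. \<forall>j<k. col M j \<bullet> y = 0}"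
proof -
  interpret vec_space "TYPE(real)" d .
  have "set (cols M) \<subseteq> carrier_vec d" using cols_dim assms by blast
  then have "orthogonal_complement (col_space M) = orthogonal_complement (set (cols M))"
    by (simp add: col_space_def)
  also have "\<dots> = {y \<in> carrier_vec d. \<forall>j<k. y \<bullet> col M j = 0}"
    using assms by (auto simp: orthogonal_complement_def cols_def)
  also have "\<dots> = {y \<in> carrier_vec d. \<forall>j<k. col M j \<bullet> y = 0}"
    using assms by (auto simp: comm_scalar_prod[of _ d])
  finally show ?thesis .
qed

text \<open>The linear program depends on \<open>A\<close> only through the range of its transpose: eliminating the multipliers
\<open>\<lambda>\<close> leaves the same orthogonality conditions, whichever basis was chosen.\<close>

lemma complement_basis_mat_range:
  assumes M: "M \<in> carrier_mat d k" and A: "complement_basis_mat M A"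
  shows "(\<exists>lam \<in> carrier_vec (dim_row A). A\<^sup>T *\<^sub>v lam = y) \<longleftrightarrow>
    y \<in> carrier_vec d \<and> (\<forall>j<k. col M j \<bullet> y = 0)"
proof -
  interpret vec_space "TYPE(real)" d .
  define C where "C = orthogonal_complement (col_space M)"
  have C: "C = {y \<in> carrier_vec d. \<forall>j<k. col M j \<bullet> y = 0}"
    unfolding C_def by (rule orthogonal_complement_col_space[OF M])
  have "set (cols M) \<subseteq> carrier_vec d" using cols_dim M by blast
  then have "col_space M \<subseteq> carrier_vec d"
    unfolding col_space_def using span_closed by blast
  then have sub: "LinearCombinations.submodule class_ring C V"
    unfolding C_def by (rule orthogonal_complement_submodule)
  obtain m where Ac: "A \<in> carrier_mat m d" and dist: "distinct (cols A\<^sup>T)"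
    and basis: "vectorspace.basis class_ring (vs C) (set (rows A))"
    using A M by (auto simp: complement_basis_mat_def Let_def C_def cols_transpose)
  have "vectorspace class_ring (vs C)"
    using sub by (intro subspace_is_vs) (simp add: VectorSpace.subspace_def vectorspace_axioms)
  then have rows: "set (rows A) \<subseteq> C"
    and "LinearCombinations.module.span class_ring (vs C) (set (rows A)) = C"
    using basis by (auto simp: vectorspace.basis_def)
  then have span: "span (set (cols A\<^sup>T)) = C"
    using span_li_not_depend(1)[OF rows sub] by simp
  have cols: "set (cols A\<^sup>T) \<subseteq> carrier_vec d" using rows C by auto
  have AT: "A\<^sup>T \<in> carrier_mat d (m)" using Ac by simp
  have "(\<exists>lam \<in> carrier_vec (m). A\<^sup>T *\<^sub>v lam = y) \<longleftrightarrow> y \<in> span (set (cols A\<^sup>T))"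
  proof
    assume "\<exists>lam \<in> carrier_vec (m). A\<^sup>T *\<^sub>v lam = y"
    then obtain lam where "lam \<in> carrier_vec (m)" "y = A\<^sup>T *\<^sub>v lam" by blast
    then have "y = lincomb (\<lambda>a. lam $ find_first a (cols A\<^sup>T)) (set (cols A\<^sup>T))"
      using lincomb_eq_mat_mult[OF AT _ dist] by simp
    then show "y \<in> span (set (cols A\<^sup>T))"
      unfolding finite_span[OF finite_set cols] by blast
  next
    assume "y \<in> span (set (cols A\<^sup>T))"
    then obtain a where "y = lincomb a (set (cols A\<^sup>T))"
      using finite_span[OF _ cols] by auto
    then show "\<exists>lam \<in> carrier_vec (m). A\<^sup>T *\<^sub>v lam = y"
      using mat_mult_eq_lincomb[OF AT dist, of a] by (intro bexI) auto
  qed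
  then show ?thesis unfolding span C using Ac by simp
qed

text \<open>\<open>2 W\<close> exchanges the two halves of a vector. This is why \<open>G x \<bullet> W (G x)\<close> equals \<open>(U x) \<bullet> (V x)\<close>.\<close>

lemma two_W_mat_mult:
  assumes "a \<in> carrier_vec r" "b \<in> carrier_vec r"
  shows "(2 \<cdot>\<^sub>m W_mat r) *\<^sub>v (a @\<^sub>v b) = b @\<^sub>v a"
proof -
  have "2 \<cdot>\<^sub>m W_mat r = four_block_mat (0\<^sub>m r r) (1\<^sub>m r) (1\<^sub>m r) (0\<^sub>m r r)"
    by (intro eq_matI) (auto simp: W_mat_def)
  moreover have "0\<^sub>m r r *\<^sub>v v = 0\<^sub>v r" if "v \<in> carrier_vec r" for v :: "real vec"
    using that by (intro eq_vecI) auto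
  ultimately show ?thesis
    using assms by (simp add: four_block_mat_mult_vec[of _ r r _ r _ r])
qed

lemma append_rows_mult_vec:
  assumes "U \<in> carrier_mat r N" "V \<in> carrier_mat s N" "x \<in> carrier_vec N"
  shows "(U @\<^sub>r V) *\<^sub>v x = (U *\<^sub>v x) @\<^sub>v (V *\<^sub>v x)"
proof -
  have x: "x = x @\<^sub>v 0\<^sub>v 0" by (intro eq_vecI) auto
  have "(U @\<^sub>r V) *\<^sub>v (x @\<^sub>v 0\<^sub>v 0) = (U *\<^sub>v x) @\<^sub>v (V *\<^sub>v x)"
    unfolding append_rows_def using assms
    by (subst four_block_mat_mult_vec[of _ r N _ 0 _ s]) auto
  then show ?thesis by (simp only: x[symmetric])
qed

lemma col_append_rows:
  assumes "U \<in> carrier_mat r N" "V \<in> carrier_mat s N" "i < N"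
  shows "col (U @\<^sub>r V) i = col U i @\<^sub>v col V i"
  using assms unfolding append_rows_def
  by (intro col_four_block_mat(1)[of _ r _ _ 0 _ s]) auto

text \<open>Links the arrangement to the optimization problem: the sign vector of the point \<open>2 W G x\<close> is the sign
pattern of the gradient at \<open>x\<close>.\<close>

lemma col_scalar_prod_two_W:
  assumes U: "U \<in> carrier_mat r N" and V: "V \<in> carrier_mat r N" and x: "x \<in> carrier_vec N"
    and i: "i < N"
  shows "col (U @\<^sub>r V) i \<bullet> ((2 \<cdot>\<^sub>m W_mat r) *\<^sub>v ((U @\<^sub>r V) *\<^sub>v x)) = gradient (U\<^sup>T * V) x $ i"
proof -
  have "(2 \<cdot>\<^sub>m W_mat r) *\<^sub>v ((U @\<^sub>r V) *\<^sub>v x) = (V *\<^sub>v x) @\<^sub>v (U *\<^sub>v x)"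
    unfolding append_rows_mult_vec[OF U V x] using U V x by (intro two_W_mat_mult) auto
  then have "col (U @\<^sub>r V) i \<bullet> ((2 \<cdot>\<^sub>m W_mat r) *\<^sub>v ((U @\<^sub>r V) *\<^sub>v x)) =
      col U i \<bullet> (V *\<^sub>v x) + col V i \<bullet> (U *\<^sub>v x)"
    unfolding col_append_rows[OF U V i]
    using U V x i by (simp add: scalar_prod_append[of _ r _ r])
  moreover have "(U\<^sup>T * V) *\<^sub>v x = U\<^sup>T *\<^sub>v (V *\<^sub>v x)" "(V\<^sup>T * U) *\<^sub>v x = V\<^sup>T *\<^sub>v (U *\<^sub>v x)"
    using U V x by (auto intro!: assoc_mult_mat_vec)
  moreover have "(U\<^sup>T * V)\<^sup>T = V\<^sup>T * U"
    using U V by (subst transpose_mult[of _ N r _ N]) auto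
  ultimately show ?thesis
    using U V i by (simp add: gradient_def)
qed

lemma subcols_mult_subvec:
  assumes "M \<in> carrier_mat d N" "distinct is" "set is \<subseteq> {..<N}"
  shows "subcols is M *\<^sub>v subvec is x = vec d (\<lambda>r. \<Sum>j\<in>set is. M $$ (r,j) * x $ j)"
proof (rule eq_vecI)
  fix r assume "r < dim_vec (vec d (\<lambda>r. \<Sum>j\<in>set is. M $$ (r,j) * x $ j))"
  then have r: "r < d" by simp
  have "(subcols is M *\<^sub>v subvec is x) $ r = (\<Sum>k<length is. M $$ (r, is ! k) * x $ (is ! k))"
    using assms r unfolding subcols_def subvec_def
    by (auto simp: scalar_prod_def mat_of_cols_def lessThan_atLeast0 subset_iff 
        vec_of_list_index intro!: sum.cong)
  also have "\<dots> = (\<Sum>j\<in>set is. M $$ (r,j) * x $ j)"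
    by (rule sum.reindex_bij_betw) (simp add: assms(2) bij_betw_nth)
  finally show "(subcols is M *\<^sub>v subvec is x) $ r = vec d (\<lambda>r. \<Sum>j\<in>set is. M $$ (r,j) * x $ j) $ r"
    using r by simp
qed (use assms in \<open>simp add: subcols_def\<close>)

lemma set_zero_pos: "set (zero_pos \<sigma>) = {i. i < dim_vec \<sigma> \<and> \<sigma> $ i = 0}"
  and set_nonzero_pos: "set (nonzero_pos \<sigma>) = {i. i < dim_vec \<sigma> \<and> \<sigma> $ i \<noteq> 0}"
  and distinct_zero_pos: "distinct (zero_pos \<sigma>)"
  and distinct_nonzero_pos: "distinct (nonzero_pos \<sigma>)"
  by (auto simp: zero_pos_def nonzero_pos_def)

lemma split_mult_mat_vec:
  assumes M: "M \<in> carrier_mat d N" and \<sigma>: "\<sigma> \<in> carrier_vec N" and x: "x \<in> carrier_vec N"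
  shows "subcols (zero_pos \<sigma>) M *\<^sub>v subvec (zero_pos \<sigma>) x +
    subcols (nonzero_pos \<sigma>) M *\<^sub>v subvec (nonzero_pos \<sigma>) x = M *\<^sub>v x"
proof -
  have 1: "set (zero_pos \<sigma>) \<subseteq> {..<N}" "set (nonzero_pos \<sigma>) \<subseteq> {..<N}"
    using \<sigma> by (auto simp: set_zero_pos set_nonzero_pos)
  have "(\<Sum>j<N. f j) = (\<Sum>j\<in>set (zero_pos \<sigma>). f j) + (\<Sum>j\<in>set (nonzero_pos \<sigma>). f j)"
    for f :: "nat \<Rightarrow> real"
  proof -
    have "{..<N} = set (zero_pos \<sigma>) \<union> set (nonzero_pos \<sigma>)"
      "set (zero_pos \<sigma>) \<inter> set (nonzero_pos \<sigma>) = {}"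
      using \<sigma> by (auto simp: set_zero_pos set_nonzero_pos)
    then show ?thesis by (simp add: sum.union_disjoint)
  qed
  then have "(M *\<^sub>v x) $ r = (\<Sum>j\<in>set (zero_pos \<sigma>). M $$ (r,j) * x $ j) +
      (\<Sum>j\<in>set (nonzero_pos \<sigma>). M $$ (r,j) * x $ j)" if "r < d" for r
    using M x that by (simp add: scalar_prod_def lessThan_atLeast0)
  then show ?thesis
    unfolding subcols_mult_subvec[OF M distinct_zero_pos 1(1)]
      subcols_mult_subvec[OF M distinct_nonzero_pos 1(2)]
    using M by (intro eq_vecI) auto
qed

lemma sign_vecsD:
  assumes "\<sigma> \<in> sign_vecs G" "G \<in> carrier_mat d N"
  shows "\<sigma> \<in> carrier_vec N" "i < N \<Longrightarrow> \<sigma> $ i \<in> {-1, 0, 1}"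
  using assms by (auto simp: sign_vecs_def sign_vec_def sgn_if split: if_splits)

text \<open>The midpoint formula picks the upper bound for sign 1 and the lower bound for sign -1.\<close>

lemma subvec_eq_fixed_part_iff:
  assumes "x \<in> carrier_vec N" "\<sigma> \<in> carrier_vec N" 
    and sgn: "\<And>i. i < N \<Longrightarrow> \<sigma> $ i \<in> {-1, 0, 1}"
  shows "subvec (nonzero_pos \<sigma>) x = fixed_part \<sigma> l u \<longleftrightarrow>
    (\<forall>i<N. \<sigma> $ i \<noteq> 0 \<longrightarrow> x $ i = (if \<sigma> $ i > 0 then u $ i else l $ i))"
proof -
  define bs where "bs = nonzero_pos \<sigma>"
  have dim: "dim_vec (subvec bs v) = length bs" for v by (simp add: subvec_def)
  have nth: "subvec bs v $ k = v $ (bs ! k)" if "k < length bs" for v k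
    using that by (simp add: subvec_def vec_of_list_index)
  have in_bs: "bs ! k < N" "\<sigma> $ (bs ! k) \<noteq> 0" if "k < length bs" for k
    using nth_mem[OF that] assms(2) by (auto simp: bs_def set_nonzero_pos)
  have fixed: "fixed_part \<sigma> l u = vec (length bs) (\<lambda>k. let i = bs ! k in if \<sigma> $ i > 0 then u $ i else l $ i)"
  proof (rule eq_vecI)
    fix k assume "k < dim_vec (vec (length bs) (\<lambda>k. let i = bs ! k in if \<sigma> $ i > 0 then u $ i else l $ i))"
    then have k: "k < length bs" by simp
    have "(mat_diag (length bs) (\<lambda>i. subvec bs \<sigma> $ i) *\<^sub>v (subvec bs u - subvec bs l)) $ k =
        (\<Sum>j<length bs. (if k = j then subvec bs \<sigma> $ j else 0) * (subvec bs u - subvec bs l) $ j)"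
      using k by (simp add: mat_diag_def scalar_prod_def dim lessThan_atLeast0)
    also have "\<dots> = (\<Sum>j<length bs. if k = j then subvec bs \<sigma> $ j * (subvec bs u - subvec bs l) $ j else 0)"
      by (intro sum.cong) auto
    also have "\<dots> = \<sigma> $ (bs ! k) * (u $ (bs ! k) - l $ (bs ! k))"
      using k by (simp add: dim nth)
    finally have "fixed_part \<sigma> l u $ k = 1/2 * (l $ (bs ! k) + u $ (bs ! k)) +
        1/2 * (\<sigma> $ (bs ! k) * (u $ (bs ! k) - l $ (bs ! k)))"
      using k by (simp add: fixed_part_def Let_def bs_def[symmetric] dim nth mat_diag_def)
    then show "fixed_part \<sigma> l u $ k =
        vec (length bs) (\<lambda>k. let i = bs ! k in if \<sigma> $ i > 0 then u $ i else l $ i) $ k"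
      using sgn[OF in_bs(1)[OF k]] in_bs(2)[OF k] k by (auto simp: Let_def field_simps)
  qed (simp add: fixed_part_def Let_def bs_def[symmetric] dim mat_diag_def)
  have "subvec bs x = fixed_part \<sigma> l u \<longleftrightarrow>
      (\<forall>k<length bs. x $ (bs ! k) = (if \<sigma> $ (bs ! k) > 0 then u $ (bs ! k) else l $ (bs ! k)))"
    unfolding fixed vec_eq_iff by (simp add: dim nth Let_def)
  also have "\<dots> \<longleftrightarrow> (\<forall>i\<in>set bs. x $ i = (if \<sigma> $ i > 0 then u $ i else l $ i))"
    by (simp add: all_set_conv_all_nth)
  also have "\<dots> \<longleftrightarrow> (\<forall>i<N. \<sigma> $ i \<noteq> 0 \<longrightarrow> x $ i = (if \<sigma> $ i > 0 then u $ i else l $ i))"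
    using carrier_vecD[OF assms(2)] unfolding bs_def set_nonzero_pos by blast
  finally show ?thesis unfolding bs_def .
qed

lemma subvec_in_box_iff:
  assumes "\<sigma> \<in> carrier_vec N"
  shows "subvec (zero_pos \<sigma>) x \<in> box (length (zero_pos \<sigma>)) (subvec (zero_pos \<sigma>) l) (subvec (zero_pos \<sigma>) u)
    \<longleftrightarrow> (\<forall>i<N. \<sigma> $ i = 0 \<longrightarrow> l $ i \<le> x $ i \<and> x $ i \<le> u $ i)"
proof -
  define as where "as = zero_pos \<sigma>"
  have "subvec as x \<in> box (length as) (subvec as l) (subvec as u)
    \<longleftrightarrow> (\<forall>i\<in>set as. l $ i \<le> x $ i \<and> x $ i \<le> u $ i)"
    unfolding all_set_conv_all_nth box_def less_eq_vec_def subvec_def carrier_vec_def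
    by (simp add: vec_of_list_index) blast
  then show ?thesis using carrier_vecD[OF assms] unfolding as_def set_zero_pos by blast
qed

text \<open>With \<open>c = 2 W G x\<close>, the equation of the linear program is \<open>A\<^sup>T \<lambda> = c\<close>. It is solvable for \<open>\<lambda>\<close> iff \<open>c\<close> is
orthogonal to the columns of \<open>G\<close> with sign zero, that is, iff the corresponding partial derivatives vanish.\<close>

lemma candidates_eq_face_stationary:
  assumes U: "U \<in> carrier_mat r N" and V: "V \<in> carrier_mat r N"
    and l: "l \<in> carrier_vec N" and u: "u \<in> carrier_vec N" and lu: "l \<le> u"
    and \<sigma>: "\<sigma> \<in> sign_vecs (U @\<^sub>r V)"
    and A: "complement_basis_mat (subcols (zero_pos \<sigma>) (U @\<^sub>r V)) A"
  shows "candidates r (U @\<^sub>r V) l u \<sigma> A = {x. face_stationary (U\<^sup>T * V) l u \<sigma> x}"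
proof (rule Set.set_eqI)
  fix x
  define G where "G = U @\<^sub>r V"
  define as where "as = zero_pos \<sigma>"
  define bs where "bs = nonzero_pos \<sigma>"
  define GA where "GA = subcols as G"
  have G: "G \<in> carrier_mat (r + r) N" using U V by (simp add: G_def carrier_append_rows)
  note \<sigma>' = sign_vecsD[OF \<sigma>[folded G_def] G]
  have GA: "GA \<in> carrier_mat (r + r) (length as)" using G by (auto simp: GA_def subcols_def)
  have W: "2 \<cdot>\<^sub>m W_mat r \<in> carrier_mat (r + r) (r + r)" by (simp add: W_mat_def)
  have lp: "(\<exists>lam. lp_solution A (W_mat r) GA (subcols bs G *\<^sub>v fixed_part \<sigma> l u)
        (subvec as l) (subvec as u) lam (subvec as x)) \<longleftrightarrow>
      (\<forall>i<N. \<sigma> $ i = 0 \<longrightarrow> l $ i \<le> x $ i \<and> x $ i \<le> u $ i \<and> gradient (U\<^sup>T * V) x $ i = 0)"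
    if x: "x \<in> carrier_vec N" and fixed: "subvec bs x = fixed_part \<sigma> l u"
  proof -
    have xA: "subvec as x \<in> carrier_vec (length as)" by (simp add: subvec_def carrier_dim_vec)
    define c where "c = (2 \<cdot>\<^sub>m W_mat r) *\<^sub>v (G *\<^sub>v x)"
    define b where "b = subcols bs G *\<^sub>v fixed_part \<sigma> l u"
    have b: "b \<in> carrier_vec (r + r)" using G by (auto simp: b_def subcols_def intro!: carrier_vecI)
    have cc: "c \<in> carrier_vec (r + r)" using W by (auto simp: c_def intro!: carrier_vecI)
    have "c = (2 \<cdot>\<^sub>m W_mat r) *\<^sub>v (GA *\<^sub>v subvec as x + b)"
      unfolding c_def b_def GA_def as_def fixed[symmetric] bs_def split_mult_mat_vec[OF G \<sigma>'(1) x] ..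
    also have "\<dots> = (2 \<cdot>\<^sub>m W_mat r) *\<^sub>v (GA *\<^sub>v subvec as x) + (2 \<cdot>\<^sub>m W_mat r) *\<^sub>v b"
      using W GA xA b by (intro mult_add_distrib_mat_vec) auto
    also have "(2 \<cdot>\<^sub>m W_mat r) *\<^sub>v (GA *\<^sub>v subvec as x) = (2 \<cdot>\<^sub>m W_mat r * GA) *\<^sub>v subvec as x"
      using W GA xA by (intro assoc_mult_mat_vec[symmetric]) auto
    finally have c: "c = (2 \<cdot>\<^sub>m W_mat r * GA) *\<^sub>v subvec as x + (2 \<cdot>\<^sub>m W_mat r) *\<^sub>v b" .
    have A': "dim_col A = r + r"
      using A GA by (auto simp: complement_basis_mat_def Let_def GA_def as_def G_def dest: carrier_matD(2))
    have eq: "(A\<^sup>T *\<^sub>v lam - (2 \<cdot>\<^sub>m W_mat r * GA) *\<^sub>v subvec as x = (2 \<cdot>\<^sub>m W_mat r) *\<^sub>v b) \<longleftrightarrow>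
        A\<^sup>T *\<^sub>v lam = c" for lam
    proof -
      have "p - q = w \<longleftrightarrow> p = q + w" 
        if "p \<in> carrier_vec (r+r)" "q \<in> carrier_vec (r+r)" "w \<in> carrier_vec (r+r)" for p q w :: "real vec"
        using that by (auto simp: vec_eq_iff)
      moreover have "A\<^sup>T *\<^sub>v lam \<in> carrier_vec (r+r)"
        "(2 \<cdot>\<^sub>m W_mat r * GA) *\<^sub>v subvec as x \<in> carrier_vec (r+r)" "(2 \<cdot>\<^sub>m W_mat r) *\<^sub>v b \<in> carrier_vec (r+r)"
        using A' W by (auto intro!: carrier_vecI)
      ultimately show ?thesis unfolding c by blast
    qed
    have "(\<exists>lam. lp_solution A (W_mat r) GA b (subvec as l) (subvec as u) lam (subvec as x)) \<longleftrightarrow>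
        subvec as x \<in> box (length as) (subvec as l) (subvec as u) \<and>
        (\<exists>lam\<in>carrier_vec (dim_row A). A\<^sup>T *\<^sub>v lam = c)"
      using GA by (auto simp: lp_solution_def eq)
    also have "(\<exists>lam\<in>carrier_vec (dim_row A). A\<^sup>T *\<^sub>v lam = c) \<longleftrightarrow> (\<forall>k<length as. col GA k \<bullet> c = 0)"
      using complement_basis_mat_range[OF GA[unfolded GA_def as_def G_def] A] cc
      by (simp add: GA_def as_def G_def)
    also have "\<dots> \<longleftrightarrow> (\<forall>k<length as. col G (as ! k) \<bullet> c = 0)"
    proof -
      have "col GA k = col G (as ! k)" if "k < length as" for k
        unfolding GA_def subcols_def using that by (subst col_mat_of_cols) (auto intro: carrier_vecI)
      then show ?thesis by simp
    qed
    also have "\<dots> \<longleftrightarrow> (\<forall>i\<in>set as. col G i \<bullet> c = 0)"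
      by (simp add: all_set_conv_all_nth)
    also have "\<dots> \<longleftrightarrow> (\<forall>i<N. \<sigma> $ i = 0 \<longrightarrow> gradient (U\<^sup>T * V) x $ i = 0)"
      using \<sigma>'(1) col_scalar_prod_two_W[OF U V x] by (auto simp: c_def G_def as_def set_zero_pos)
    finally show ?thesis
      unfolding b_def[symmetric] using subvec_in_box_iff[OF \<sigma>'(1), folded as_def] by auto
  qed
  have "x \<in> candidates r G l u \<sigma> A \<longleftrightarrow>
      x \<in> carrier_vec N \<and> subvec bs x = fixed_part \<sigma> l u \<and>
      (\<exists>lam. lp_solution A (W_mat r) GA (subcols bs G *\<^sub>v fixed_part \<sigma> l u)
        (subvec as l) (subvec as u) lam (subvec as x))"
    unfolding candidates_def Let_def as_def[symmetric] bs_def[symmetric] GA_def[symmetric]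
    using carrier_matD(2)[OF G] by simp
  also have "\<dots> \<longleftrightarrow> x \<in> carrier_vec N \<and> subvec bs x = fixed_part \<sigma> l u \<and>
      (\<forall>i<N. \<sigma> $ i = 0 \<longrightarrow> l $ i \<le> x $ i \<and> x $ i \<le> u $ i \<and> gradient (U\<^sup>T * V) x $ i = 0)"
    using lp by blast
  also have "\<dots> \<longleftrightarrow> x \<in> carrier_vec N \<and>
      (\<forall>i<N. \<sigma> $ i \<noteq> 0 \<longrightarrow> x $ i = (if \<sigma> $ i > 0 then u $ i else l $ i)) \<and>
      (\<forall>i<N. \<sigma> $ i = 0 \<longrightarrow> l $ i \<le> x $ i \<and> x $ i \<le> u $ i \<and> gradient (U\<^sup>T * V) x $ i = 0)"
    using subvec_eq_fixed_part_iff[OF _ \<sigma>', folded bs_def] by blast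
  also have "\<dots> \<longleftrightarrow> face_stationary (U\<^sup>T * V) l u \<sigma> x"
  proof -
    have le: "l $ i \<le> u $ i" if "i < N" for i using lu u that by (auto simp: less_eq_vec_def)
    have pointwise: "(\<sigma> $ i \<noteq> 0 \<longrightarrow> x $ i = (if \<sigma> $ i > 0 then u $ i else l $ i)) \<and>
        (\<sigma> $ i = 0 \<longrightarrow> l $ i \<le> x $ i \<and> x $ i \<le> u $ i \<and> gradient (U\<^sup>T * V) x $ i = 0) \<longleftrightarrow>
        l $ i \<le> x $ i \<and> x $ i \<le> u $ i \<and>
        (if \<sigma> $ i = 0 then gradient (U\<^sup>T * V) x $ i = 0
         else x $ i = (if \<sigma> $ i > 0 then u $ i else l $ i))" if "i < N" for i
      using le[OF that] by (cases "\<sigma> $ i = 0") auto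
    show ?thesis
    proof (cases "x \<in> carrier_vec N")
      case True
      then show ?thesis
        unfolding face_stationary_def box_def less_eq_vec_def mem_Collect_eq
          carrier_vecD[OF \<sigma>'(1)] carrier_vecD[OF l] carrier_vecD[OF u] carrier_vecD[OF True]
        using pointwise by blast
    next
      case False
      then show ?thesis using \<sigma>'(1) by (simp add: face_stationary_def box_def)
    qed
  qed
  finally show "x \<in> candidates r (U @\<^sub>r V) l u \<sigma> A \<longleftrightarrow> x \<in> {x. face_stationary (U\<^sup>T * V) l u \<sigma> x}"
    by (simp add: G_def)
qed

section \<open>Rational factorizations and complement bases\<close>

lemma elements_mat_subset_iff:
  "elements_mat A \<subseteq> S \<longleftrightarrow> (\<forall>i<dim_row A. \<forall>j<dim_col A. A $$ (i,j) \<in> S)"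
  by (fastforce simp: elements_mat_def)

text \<open>The matrix is the image of one over the field of rationals, and the image of the inverse of that matrix
is an inverse of the original one.\<close>

lemma rational_inverse_mat:
  fixes P :: "real mat"
  assumes P: "P \<in> carrier_mat d d" and rat: "elements_mat P \<subseteq> \<rat>" and det: "det P \<noteq> 0"
  obtains R where "R \<in> carrier_mat d d" "elements_mat R \<subseteq> \<rat>" "P * R = 1\<^sub>m d" "R * P = 1\<^sub>m d"
proof -
  \<comment> \<open>On rational entries the inverse of the embedding recovers the rational number.\<close>
  define P' where "P' = map_mat (inv_into UNIV (of_rat :: rat \<Rightarrow> real)) P"
  have P': "P' \<in> carrier_mat d d" using P by (simp add: P'_def)
  have P_eq: "P = map_mat of_rat P'"
  proof (rule eq_matI)
    fix i j assume "i < dim_row (map_mat real_of_rat P')" "j < dim_col (map_mat real_of_rat P')"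
    then have ij: "i < d" "j < d" using P' by auto
    then have "P $$ (i,j) \<in> range of_rat"
      using rat P by (auto simp: elements_mat_subset_iff Rats_def)
    then show "P $$ (i,j) = map_mat of_rat P' $$ (i,j)"
      using ij P by (simp add: P'_def f_inv_into_f)
  qed (simp_all add: P'_def)
  have "det P' \<noteq> 0" using det unfolding P_eq of_rat_hom.hom_det by auto
  then obtain R' where R': "R' \<in> carrier_mat d d" "P' * R' = 1\<^sub>m d" "R' * P' = 1\<^sub>m d"
    using det_non_zero_imp_unit[OF P'] unfolding Units_def ring_mat_def by auto
  show thesis
  proof
    show "map_mat of_rat R' \<in> carrier_mat d d" using R' by simp
    show "elements_mat (map_mat real_of_rat R') \<subseteq> \<rat>"
      by (auto simp: elements_mat_subset_iff)
    show "P * map_mat of_rat R' = 1\<^sub>m d" "map_mat of_rat R' * P = 1\<^sub>m d"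
      unfolding P_eq of_rat_hom.mat_hom_mult[OF P' R'(1), symmetric]
        of_rat_hom.mat_hom_mult[OF R'(1) P', symmetric] R'(2,3)
      by (rule of_rat_hom.mat_hom_one)+
  qed
qed

lemma (in vec_space) maximal_lin_indpt_subset_spans:
  assumes S: "S \<subseteq> carrier_vec n" and max: "maximal U (\<lambda>T. T \<subseteq> S \<and> lin_indpt T)"
  shows "S \<subseteq> span U"
proof
  fix s assume s: "s \<in> S"
  have U: "U \<subseteq> S" "lin_indpt U" using max by (auto simp: maximal_def)
  then have Uc: "U \<subseteq> carrier_vec n" using S by auto
  show "s \<in> span U"
  proof (rule ccontr)
    assume ns: "s \<notin> span U"
    have sU: "s \<notin> U" using ns Uc span_mem by blast
    have "lin_indpt (U \<union> {s})"
      using lin_dep_iff_in_span[OF _ U(2) _ sU] ns Uc S s by auto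
    with max s U sU show False unfolding maximal_def by blast
  qed
qed

text \<open>The first \<open>rank M\<close> columns of \<open>P\<close> are a maximal independent set of columns of \<open>M\<close>, completed to a basis
by unit vectors; all these vectors are rational. The last conclusion records, in dual form, that
the leading columns of \<open>P\<close> and the columns of \<open>M\<close> span the same space.\<close>

lemma rational_adapted_basis:
  fixes M :: "real mat"
  assumes M: "M \<in> carrier_mat d k" and rat: "elements_mat M \<subseteq> \<rat>"
  obtains P R where "P \<in> carrier_mat d d" "R \<in> carrier_mat d d"
    "elements_mat P \<subseteq> \<rat>" "elements_mat R \<subseteq> \<rat>" "P * R = 1\<^sub>m d" "R * P = 1\<^sub>m d"
    "vec_space.rank d M \<le> d"
    "\<And>y. y \<in> carrier_vec d \<Longrightarrow>
      (\<forall>j<k. col M j \<bullet> y = 0) \<longleftrightarrow> (\<forall>i<vec_space.rank d M. col P i \<bullet> y = 0)"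
proof -
  interpret vec_space "TYPE(real)" d .
  define S where "S = set (cols M)"
  define T where "T = S \<union> set (unit_vecs d)"
  have Sc: "S \<subseteq> carrier_vec d" unfolding S_def using cols_dim M by blast
  have Tc: "T \<subseteq> carrier_vec d" unfolding T_def unit_vecs_def using Sc by auto
  have fin: "finite S" "finite T" by (auto simp: S_def T_def)
  have "lin_indpt {}" by (rule finite_lin_indpt2) auto
  then obtain B where B: "maximal B (\<lambda>X. X \<subseteq> S \<and> lin_indpt X)" "finite B"
    using maximal_exists_superset[of S "\<lambda>X. X \<subseteq> S \<and> lin_indpt X" "{}"] fin by auto
  then have BS: "B \<subseteq> S" "lin_indpt B" by (auto simp: maximal_def)
  obtain U where U: "maximal U (\<lambda>X. X \<subseteq> T \<and> lin_indpt X)" "finite U" "B \<subseteq> U"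
    using maximal_exists_superset[of T "\<lambda>X. X \<subseteq> T \<and> lin_indpt X" B] fin BS by (auto simp: T_def)
  then have UT: "U \<subseteq> T" "lin_indpt U" by (auto simp: maximal_def)
  then have Uc: "U \<subseteq> carrier_vec d" using Tc by blast
  have rank: "rank M = card B"
    using rank_card_indpt[OF M] B(1) by (simp add: S_def)
  have "set (unit_vecs d) \<subseteq> span U"
    using maximal_lin_indpt_subset_spans[OF Tc U(1)] by (auto simp: T_def)
  then have "carrier_vec d \<subseteq> span U"
    using UT Tc span_is_subset[of "set (unit_vecs d)" "span U"] span_is_submodule[of U]
    by (simp add: span_unit_vecs_is_carrier)
  then have "basis U"
    using UT Uc span_closed[OF Uc] unfolding basis_def by auto
  then have cardU: "card U = d" using dim_basis[OF U(2)] dim_is_n by simp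
  obtain bs where bs: "set bs = B" "distinct bs" using finite_distinct_list[OF B(2)] by auto
  obtain us where us: "set us = U - B" "distinct us"
    using finite_distinct_list[of "U - B"] U(2) by auto
  define P where "P = mat_of_cols d (bs @ us)"
  have set: "set (bs @ us) = U" and dist: "distinct (bs @ us)" using bs us U(3) by auto
  have len: "length (bs @ us) = d" using distinct_card[OF dist] set cardU by simp
  have lbs: "length bs = rank M" using distinct_card[OF bs(2)] bs(1) rank by simp
  have P: "P \<in> carrier_mat d d" unfolding P_def using mat_of_cols_carrier(1)[of d "bs @ us"] len by metis
  have "set (bs @ us) \<subseteq> carrier_vec d" unfolding set using UT Tc by auto
  then have cols: "cols P = bs @ us" unfolding P_def by (rule cols_mat_of_cols)
  have "rank P = d"
    using lin_indpt_full_rank[OF P] UT dist set cols by simp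
  then have "det P \<noteq> 0" using det_rank_iff[OF P] by simp
  moreover have ratP: "elements_mat P \<subseteq> \<rat>"
    unfolding elements_mat_subset_iff
  proof (intro allI impI)
    fix i j assume "i < dim_row P" "j < dim_col P"
    then have ij: "i < d" "j < d" using P by auto
    then have "P $$ (i,j) = cols P ! j $ i" using P by simp
    moreover have "cols P ! j \<in> T" using ij P UT set cols len nth_mem[of j "bs @ us"] by auto
    moreover have "v $ i \<in> \<rat>" if "v \<in> T" for v
      using that ij M rat
      by (auto simp: T_def S_def cols_def unit_vecs_def unit_vec_def elements_mat_subset_iff)
    ultimately show "P $$ (i,j) \<in> \<rat>" by simp
  qed
  ultimately obtain R where R: "R \<in> carrier_mat d d" "elements_mat R \<subseteq> \<rat>"
      "P * R = 1\<^sub>m d" "R * P = 1\<^sub>m d"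
    using rational_inverse_mat[OF P] by blast
  have "orthogonal_complement S = orthogonal_complement B"
  proof
    show "orthogonal_complement S \<subseteq> orthogonal_complement B"
      by (rule orthogonal_complement_subset[OF BS(1)])
    have "orthogonal_complement (span B) \<subseteq> orthogonal_complement S"
      by (rule orthogonal_complement_subset[OF maximal_lin_indpt_subset_spans[OF Sc B(1)]])
    then show "orthogonal_complement B \<subseteq> orthogonal_complement S"
      using BS Sc by simp
  qed
  moreover have "orthogonal_complement S = {y \<in> carrier_vec d. \<forall>j<k. col M j \<bullet> y = 0}"
    using orthogonal_complement_col_space[OF M] Sc by (simp add: col_space_def S_def)
  moreover have "orthogonal_complement B = {y \<in> carrier_vec d. \<forall>i<rank M. col P i \<bullet> y = 0}"
  proof -
    have "col P i = bs ! i" if "i < rank M" for i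
      using cols that lbs len P by (metis cols_nth carrier_matD(2) length_append nth_append trans_less_add1)
    then have "(\<forall>i<rank M. col P i \<bullet> y = 0) \<longleftrightarrow> (\<forall>v\<in>B. v \<bullet> y = 0)" for y
      unfolding bs(1)[symmetric] all_set_conv_all_nth lbs by simp
    moreover have "(\<forall>v\<in>B. v \<bullet> y = 0) \<longleftrightarrow> (\<forall>v\<in>B. y \<bullet> v = 0)" if "y \<in> carrier_vec d" for y
      using comm_scalar_prod[OF that] BS(1) Sc by (metis subsetD)
    ultimately show ?thesis unfolding orthogonal_complement_def by blast
  qed
  ultimately have "\<And>y. y \<in> carrier_vec d \<Longrightarrow>
      (\<forall>j<k. col M j \<bullet> y = 0) \<longleftrightarrow> (\<forall>i<rank M. col P i \<bullet> y = 0)"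
    by blast
  with P R ratP show thesis
    using that[of P R] lbs len by simp
qed

text \<open>\<open>M = P (R M)\<close>, and the rows of \<open>R M\<close> from index \<open>rank M\<close> on are zero: the corresponding rows of \<open>R\<close> are
orthogonal to the leading columns of \<open>P\<close>, because \<open>R P = 1\<close>, and hence to the columns of \<open>M\<close>. Cutting the
product after the first \<open>rank M\<close> terms loses nothing.\<close>

lemma rational_rank_factorization:
  fixes M :: "real mat"
  assumes M: "M \<in> carrier_mat d k" and rat: "elements_mat M \<subseteq> \<rat>"
  obtains U V where "U \<in> carrier_mat (vec_space.rank d M) d" "V \<in> carrier_mat (vec_space.rank d M) k"
    "elements_mat U \<subseteq> \<rat>" "elements_mat V \<subseteq> \<rat>" "U\<^sup>T * V = M"
proof -
  obtain P R where P: "P \<in> carrier_mat d d" and R: "R \<in> carrier_mat d d"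
    and ratP: "elements_mat P \<subseteq> \<rat>" and ratR: "elements_mat R \<subseteq> \<rat>"
    and PR: "P * R = 1\<^sub>m d" and RP: "R * P = 1\<^sub>m d" and le: "vec_space.rank d M \<le> d"
    and orth: "\<And>y. y \<in> carrier_vec d \<Longrightarrow>
      (\<forall>j<k. col M j \<bullet> y = 0) \<longleftrightarrow> (\<forall>i<vec_space.rank d M. col P i \<bullet> y = 0)"
    using rational_adapted_basis[OF M rat] by metis
  define r where "r = vec_space.rank d M"
  define RM where "RM = R * M"
  have RM: "RM \<in> carrier_mat d k" using R M by (simp add: RM_def)
  define U where "U = mat r d (\<lambda>(i,j). P $$ (j,i))"
  define V where "V = mat r k (\<lambda>ij. RM $$ ij)"
  have zero: "RM $$ (i,j) = 0" if i: "r \<le> i" "i < d" and j: "j < k" for i j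
  proof -
    have "col P i' \<bullet> row R i = 0" if "i' < r" for i'
    proof -
      have "col P i' \<bullet> row R i = row R i \<bullet> col P i'"
        using P R i by (intro comm_scalar_prod[of _ d]) auto
      also have "\<dots> = (R * P) $$ (i,i')"
        using P R i that le by (simp add: r_def)
      also have "\<dots> = 0" unfolding RP using i that by simp
      finally show ?thesis .
    qed
    then have "col M j \<bullet> row R i = 0"
      using orth[of "row R i"] R i j by (auto simp: r_def)
    moreover have "col M j \<bullet> row R i = row R i \<bullet> col M j"
      using M R i j by (intro comm_scalar_prod[of _ d]) auto
    ultimately show ?thesis using R M i j by (simp add: RM_def)
  qed
  have "U\<^sup>T * V = P * RM"
  proof (rule eq_matI)
    fix a j assume "a < dim_row (P * RM)" "j < dim_col (P * RM)"
    then have aj: "a < d" "j < k" using P RM by auto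
    have "(U\<^sup>T * V) $$ (a,j) = (\<Sum>i<r. P $$ (a,i) * RM $$ (i,j))"
      using aj by (simp add: U_def V_def scalar_prod_def lessThan_atLeast0)
    also have "\<dots> = (\<Sum>i<d. P $$ (a,i) * RM $$ (i,j))"
      using le zero aj by (intro sum.mono_neutral_left) (auto simp: r_def not_less)
    also have "\<dots> = (P * RM) $$ (a,j)"
      using aj P RM by (simp add: scalar_prod_def lessThan_atLeast0)
    finally show "(U\<^sup>T * V) $$ (a,j) = (P * RM) $$ (a,j)" .
  qed (use P RM in \<open>auto simp: U_def V_def\<close>)
  also have "\<dots> = M"
    unfolding RM_def using assoc_mult_mat[OF P R M] PR M by simp
  finally have UV: "U\<^sup>T * V = M" .
  have "RM $$ (i,j) \<in> \<rat>" if "i < d" "j < k" for i j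
    using that R M rat ratR
    by (auto simp: RM_def scalar_prod_def elements_mat_subset_iff intro!: Rats_sum Rats_mult)
  then have "elements_mat V \<subseteq> \<rat>" "elements_mat U \<subseteq> \<rat>"
    using le ratP P by (auto simp: elements_mat_subset_iff V_def U_def r_def)
  moreover have "U \<in> carrier_mat r d" "V \<in> carrier_mat r k"
    by (auto simp: U_def V_def)
  ultimately show thesis
    using that UV by (simp add: r_def)
qed

text \<open>The rows of \<open>R\<close> are the basis dual to the columns of \<open>P\<close>. So the rows of \<open>R\<close> after the first \<open>rank M\<close>
annihilate the leading columns of \<open>P\<close>, and a vector that is orthogonal to these columns has no component
along the other rows of \<open>R\<close>.\<close>

lemma complement_basis_mat_exists:
  fixes M :: "real mat"
  assumes M: "M \<in> carrier_mat d k" and rat: "elements_mat M \<subseteq> \<rat>"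
  shows "\<exists>A. complement_basis_mat M A"
proof -
  obtain P R where P: "P \<in> carrier_mat d d" and R: "R \<in> carrier_mat d d"
    and ratR: "elements_mat R \<subseteq> \<rat>"
    and PR: "P * R = 1\<^sub>m d" and RP: "R * P = 1\<^sub>m d" and le: "vec_space.rank d M \<le> d"
    and orth: "\<And>y. y \<in> carrier_vec d \<Longrightarrow>
      (\<forall>j<k. col M j \<bullet> y = 0) \<longleftrightarrow> (\<forall>i<vec_space.rank d M. col P i \<bullet> y = 0)"
    using rational_adapted_basis[OF M rat] by metis
  interpret vec_space "TYPE(real)" d .
  define r where "r = rank M"
  define C where "C = orthogonal_complement (col_space M)"
  have C: "C = {y \<in> carrier_vec d. \<forall>i<r. col P i \<bullet> y = 0}"
    unfolding C_def r_def orthogonal_complement_col_space[OF M] using orth by blast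
  have "set (cols M) \<subseteq> carrier_vec d" using cols_dim M by blast
  then have "col_space M \<subseteq> carrier_vec d"
    unfolding col_space_def using span_closed by blast
  then have sub: "LinearCombinations.submodule class_ring C V"
    unfolding C_def by (rule orthogonal_complement_submodule)
  define A where "A = mat (d - r) d (\<lambda>(i,j). R $$ (r + i, j))"
  have A: "A \<in> carrier_mat (d - r) d" by (simp add: A_def)
  have rowA: "row A i = row R (r + i)" if "i < d - r" for i
    using that R by (intro eq_vecI) (auto simp: A_def)
  have dual: "row R i \<bullet> col P j = (if i = j then 1 else 0)" if "i < d" "j < d" for i j
  proof -
    have "row R i \<bullet> col P j = (R * P) $$ (i,j)" using that R P by simp
    then show ?thesis using that by (simp add: RP)
  qed
  \<comment> \<open>by duality, the last columns of \<open>P\<close> detect the coefficients of a combination of the rows of \<open>A\<close>\<close>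
  have A_col: "A *\<^sub>v col P (r + i) = unit_vec (d - r) i" if "i < d - r" for i
    using that A by (intro eq_vecI) (auto simp: rowA dual unit_vec_def)
  have AT: "A\<^sup>T \<in> carrier_mat d (d - r)" using A by simp
  have dist: "distinct (rows A)"
  proof (rule ccontr)
    assume "\<not> distinct (rows A)"
    then obtain i j where ij: "i < d - r" "j < d - r" "i \<noteq> j" "row A i = row A j"
      using A by (auto simp: distinct_conv_nth)
    then have "row R (r + i) \<bullet> col P (r + i) = row R (r + j) \<bullet> col P (r + i)"
      by (simp add: rowA)
    then show False using ij by (simp add: dual)
  qed
  have distc: "distinct (cols A\<^sup>T)" using dist by simp
  have li: "lin_indpt (set (rows A))"
  proof
    assume "lin_dep (set (rows A))"
    then have "lin_dep (set (cols A\<^sup>T))" by simp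
    then obtain v where v: "v \<in> carrier_vec (d - r)" "v \<noteq> 0\<^sub>v (d - r)" "A\<^sup>T *\<^sub>v v = 0\<^sub>v d"
      using lin_depE[OF AT _ distc] by blast
    have "v $ i = 0" if i: "i < d - r" for i
    proof -
      have c: "col P (r + i) \<in> carrier_vec d" using P i by auto
      have "v $ i = v \<bullet> (A *\<^sub>v col P (r + i))"
        unfolding A_col[OF i] using v(1) i by simp
      also have "\<dots> = (A\<^sup>T *\<^sub>v v) \<bullet> col P (r + i)"
        by (rule transpose_vec_mult_scalar[OF A c v(1), symmetric])
      also have "\<dots> = 0" unfolding v(3) using c by simp
      finally show ?thesis .
    qed
    then show False using v(1,2) by (auto simp: vec_eq_iff)
  qed
  have rowsC: "set (rows A) \<subseteq> C"
  proof
    fix v assume "v \<in> set (rows A)"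
    then obtain i where i: "i < d - r" "v = row R (r + i)"
      using A rowA by (auto simp: in_set_conv_nth)
    have "col P j \<bullet> v = 0" if "j < r" for j
    proof -
      have "col P j \<bullet> v = row R (r + i) \<bullet> col P j"
        using P R i by (auto intro!: comm_scalar_prod[of _ d])
      then show ?thesis using i that le by (simp add: dual r_def)
    qed
    then show "v \<in> C" unfolding C using R i by auto
  qed
  have "C \<subseteq> span (set (rows A))"
  proof
    fix y assume "y \<in> C"
    then have y: "y \<in> carrier_vec d" and y0: "\<And>i. i < r \<Longrightarrow> col P i \<bullet> y = 0" by (auto simp: C)
    define lam where "lam = vec (d - r) (\<lambda>i. col P (r + i) \<bullet> y)"
    have "A\<^sup>T *\<^sub>v lam = R\<^sup>T *\<^sub>v (P\<^sup>T *\<^sub>v y)"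
    proof (rule eq_vecI)
      fix a assume "a < dim_vec (R\<^sup>T *\<^sub>v (P\<^sup>T *\<^sub>v y))"
      then have a: "a < d" using R by simp
      have "(R\<^sup>T *\<^sub>v (P\<^sup>T *\<^sub>v y)) $ a = (\<Sum>i<d. R $$ (i,a) * (col P i \<bullet> y))"
        using a R P by (simp add: scalar_prod_def lessThan_atLeast0)
      also have "\<dots> = (\<Sum>i\<in>{r..<d}. R $$ (i,a) * (col P i \<bullet> y))"
        using y0 by (intro sum.mono_neutral_right) (auto simp: not_le)
      also have "\<dots> = (\<Sum>i<d - r. R $$ (r + i,a) * (col P (r + i) \<bullet> y))"
        by (rule sum.reindex_bij_witness[of _ "\<lambda>i. r + i" "\<lambda>i. i - r"]) auto
      also have "\<dots> = (A\<^sup>T *\<^sub>v lam) $ a"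
        using a by (simp add: A_def lam_def scalar_prod_def lessThan_atLeast0)
      finally show "(A\<^sup>T *\<^sub>v lam) $ a = (R\<^sup>T *\<^sub>v (P\<^sup>T *\<^sub>v y)) $ a" by simp
    qed (use A R in auto)
    also have "\<dots> = (R\<^sup>T * P\<^sup>T) *\<^sub>v y"
      using R P y by (intro assoc_mult_mat_vec[symmetric]) auto
    also have "R\<^sup>T * P\<^sup>T = 1\<^sub>m d"
      using transpose_mult[OF P R] PR by simp
    finally have "y = A\<^sup>T *\<^sub>v lam" using y by simp
    also have "\<dots> = lincomb (\<lambda>a. lam $ find_first a (cols A\<^sup>T)) (set (cols A\<^sup>T))"
      using lincomb_eq_mat_mult[OF AT _ distc, of lam] by (simp add: lam_def)
    finally show "y \<in> span (set (rows A))"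
      using finite_span[of "set (rows A)"] rowsC C by auto
  qed
  moreover have "span (set (rows A)) \<subseteq> C"
    by (rule span_is_subset[OF rowsC sub])
  ultimately have "span (set (rows A)) = C" by blast
  moreover have "vectorspace class_ring (vs C)"
    using sub by (intro subspace_is_vs) (simp add: VectorSpace.subspace_def vectorspace_axioms)
  ultimately have "vectorspace.basis class_ring (vs C) (set (rows A))"
    using span_li_not_depend[OF rowsC sub] li rowsC by (simp add: vectorspace.basis_def)
  moreover have "elements_mat A \<subseteq> \<rat>"
    using ratR R by (auto simp: elements_mat_subset_iff A_def)
  ultimately show ?thesis
    using A dist M unfolding complement_basis_mat_def Let_def
    by (intro exI[of _ A]) (auto simp: C_def r_def)
qed

section \<open>Processing the sign vectors\<close>

text \<open>The invariant of the loop. The value \<open>-\<infinity>\<close> marks that no candidate has been recorded so far; the point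
of the state is then the meaningless initial one.\<close>

definition attained :: "nat \<Rightarrow> real mat \<Rightarrow> real vec \<Rightarrow> real vec \<Rightarrow> ereal \<times> real vec \<Rightarrow> bool" where
  "attained N Q l u s \<longleftrightarrow> fst s = -\<infinity> \<or>
     snd s \<in> box N l u \<and> fst s = ereal (snd s \<bullet> (Q *\<^sub>v snd s))"

text \<open>The last conclusion speaks of every stationary point of the face, not only of the candidate that was
chosen: all of them have the same value.\<close>

lemma process_sign_step:
  assumes U: "U \<in> carrier_mat r N" and V: "V \<in> carrier_mat r N"
    and l: "l \<in> carrier_vec N" and u: "u \<in> carrier_vec N" and lu: "l \<le> u"
    and \<sigma>: "\<sigma> \<in> sign_vecs (U @\<^sub>r V)" and Q: "Q = U\<^sup>T * V"
    and step: "process_sign r Q (U @\<^sub>r V) l u \<sigma> s s'"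
  shows "fst s \<le> fst s'" "attained N Q l u s \<Longrightarrow> attained N Q l u s'"
    "face_stationary Q l u \<sigma> x \<Longrightarrow> ereal (x \<bullet> (Q *\<^sub>v x)) \<le> fst s'"
proof -
  have \<sigma>c: "\<sigma> \<in> carrier_vec N"
    using sign_vecsD(1)[OF \<sigma>, of "r + r" N] U V by simp
  have Qc: "Q \<in> carrier_mat N N" using U V Q by simp
  obtain A where A: "complement_basis_mat (subcols (zero_pos \<sigma>) (U @\<^sub>r V)) A"
    and s': "if candidates r (U @\<^sub>r V) l u \<sigma> A = {} then s' = s
      else \<exists>y \<in> candidates r (U @\<^sub>r V) l u \<sigma> A. s' = update Q y s"
    using step unfolding process_sign_def by blast
  have cand: "candidates r (U @\<^sub>r V) l u \<sigma> A = {x. face_stationary Q l u \<sigma> x}"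
    unfolding Q by (rule candidates_eq_face_stationary[OF U V l u lu \<sigma> A])
  have "(s' = s \<and> (\<forall>x. \<not> face_stationary Q l u \<sigma> x)) \<or>
    (\<exists>y. face_stationary Q l u \<sigma> y \<and> s' = update Q y s)"
    using s' unfolding cand by (auto split: if_splits)
  then consider "s' = s" "\<And>x. \<not> face_stationary Q l u \<sigma> x"
    | y where "face_stationary Q l u \<sigma> y" "s' = update Q y s" by blast
  then have "fst s \<le> fst s' \<and> (attained N Q l u s \<longrightarrow> attained N Q l u s') \<and>
    (face_stationary Q l u \<sigma> x \<longrightarrow> ereal (x \<bullet> (Q *\<^sub>v x)) \<le> fst s')"
  proof cases
    case 1
    then show ?thesis by simp
  next
    case (2 y)
    then have "y \<in> box N l u" using \<sigma>c by (simp add: face_stationary_def)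
    moreover have "x \<bullet> (Q *\<^sub>v x) = y \<bullet> (Q *\<^sub>v y)" if "face_stationary Q l u \<sigma> x"
      by (rule face_stationary_same_value[OF Qc \<sigma>c that 2(1)])
    ultimately show ?thesis
      unfolding 2(2) by (cases s) (auto simp: update_def attained_def)
  qed
  then show "fst s \<le> fst s'" "attained N Q l u s \<Longrightarrow> attained N Q l u s'"
    "face_stationary Q l u \<sigma> x \<Longrightarrow> ereal (x \<bullet> (Q *\<^sub>v x)) \<le> fst s'" by blast+
qed

lemma process_signs_invariant:
  assumes U: "U \<in> carrier_mat r N" and V: "V \<in> carrier_mat r N"
    and l: "l \<in> carrier_vec N" and u: "u \<in> carrier_vec N" and lu: "l \<le> u" and Q: "Q = U\<^sup>T * V"
    and run: "process_signs r Q (U @\<^sub>r V) l u \<sigma>s s s'" and sub: "set \<sigma>s \<subseteq> sign_vecs (U @\<^sub>r V)"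
  shows "fst s \<le> fst s' \<and> (attained N Q l u s \<longrightarrow> attained N Q l u s') \<and>
    (\<forall>\<sigma>\<in>set \<sigma>s. \<forall>x. face_stationary Q l u \<sigma> x \<longrightarrow> ereal (x \<bullet> (Q *\<^sub>v x)) \<le> fst s')"
  using run sub
proof induction
  case (nil s)
  then show ?case by simp
next
  case (cons \<sigma> s s' \<sigma>s s'')
  then have \<sigma>: "\<sigma> \<in> sign_vecs (U @\<^sub>r V)" by simp
  note step = process_sign_step[OF U V l u lu \<sigma> Q cons.hyps(1)]
  show ?case using step cons.IH cons.prems by (auto intro: order_trans)
qed

text \<open>A maximizer is a candidate for the sign vector of the point \<open>2 W G x\<close>, so the recorded value is at least
the maximum. It is finite, hence attained at the recorded feasible point.\<close>

lemma process_signs_maximizes: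
  assumes U: "U \<in> carrier_mat r N" and V: "V \<in> carrier_mat r N"
    and l: "l \<in> carrier_vec N" and u: "u \<in> carrier_vec N" and lu: "l \<le> u" and Q: "Q = U\<^sup>T * V"
    and run: "process_signs r Q (U @\<^sub>r V) l u \<sigma>s (-\<infinity>, x0) (f, x)"
    and \<sigma>s: "set \<sigma>s = sign_vecs (U @\<^sub>r V)"
  shows "x \<in> box N l u" "f = ereal (x \<bullet> (Q *\<^sub>v x))"
    "z \<in> box N l u \<Longrightarrow> z \<bullet> (Q *\<^sub>v z) \<le> x \<bullet> (Q *\<^sub>v x)"
proof -
  have Qc: "Q \<in> carrier_mat N N" using U V Q by simp
  obtain xm where xm: "xm \<in> box N l u"
    and max: "\<And>z. z \<in> box N l u \<Longrightarrow> z \<bullet> (Q *\<^sub>v z) \<le> xm \<bullet> (Q *\<^sub>v xm)"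
    using quadratic_form_attains_max_on_box[OF Qc l lu] by blast
  then have xmc: "xm \<in> carrier_vec N" by (simp add: box_def)
  define \<sigma> where "\<sigma> = vec N (\<lambda>i. sgn (gradient Q xm $ i))"
  define y where "y = (2 \<cdot>\<^sub>m W_mat r) *\<^sub>v ((U @\<^sub>r V) *\<^sub>v xm)"
  have G: "U @\<^sub>r V \<in> carrier_mat (r + r) N" using U V by simp
  have "y \<in> carrier_vec (r + r)" by (auto simp: y_def W_mat_def intro: carrier_vecI)
  moreover have "\<sigma> = sign_vec (U @\<^sub>r V) y"
    using G col_scalar_prod_two_W[OF U V xmc]
    by (intro eq_vecI) (auto simp: \<sigma>_def sign_vec_def y_def Q)
  ultimately have "\<sigma> \<in> set \<sigma>s" using G by (auto simp: \<sigma>s sign_vecs_def)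
  moreover have "face_stationary Q l u \<sigma> xm"
    unfolding \<sigma>_def by (rule box_maximizer_face_stationary[OF Qc l u xm max])
  ultimately have "ereal (xm \<bullet> (Q *\<^sub>v xm)) \<le> f" and "attained N Q l u (f, x)"
    using process_signs_invariant[OF U V l u lu Q run] \<sigma>s by (auto simp: attained_def)
  then show x: "x \<in> box N l u" and f: "f = ereal (x \<bullet> (Q *\<^sub>v x))"
    by (auto simp: attained_def)
  show "z \<bullet> (Q *\<^sub>v z) \<le> x \<bullet> (Q *\<^sub>v x)" if "z \<in> box N l u"
    using max[OF that] \<open>ereal (xm \<bullet> (Q *\<^sub>v xm)) \<le> f\<close> f by simp
qed

lemma process_signs_exists:
  assumes G: "G \<in> carrier_mat d N" and rat: "elements_mat G \<subseteq> \<rat>"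
    and "set \<sigma>s \<subseteq> sign_vecs G"
  shows "\<exists>s'. process_signs r Q G l u \<sigma>s s s'"
  using assms(3)
proof (induction \<sigma>s arbitrary: s)
  case Nil
  show ?case by (blast intro: process_signs.nil)
next
  case (Cons \<sigma> \<sigma>s)
  then have \<sigma>: "\<sigma> \<in> carrier_vec N" using sign_vecsD(1)[OF _ G] by simp
  have "elements_mat (subcols (zero_pos \<sigma>) G) \<subseteq> \<rat>"
    unfolding elements_mat_subset_iff
  proof (intro allI impI)
    fix i j assume "i < dim_row (subcols (zero_pos \<sigma>) G)" "j < dim_col (subcols (zero_pos \<sigma>) G)"
    then have ij: "i < d" "j < length (zero_pos \<sigma>)" using G by (auto simp: subcols_def)
    then have "zero_pos \<sigma> ! j < N" using nth_mem[of j "zero_pos \<sigma>"] \<sigma> by (simp add: set_zero_pos)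
    then show "subcols (zero_pos \<sigma>) G $$ (i, j) \<in> \<rat>"
      using ij G rat by (simp add: subcols_def mat_of_cols_def elements_mat_subset_iff)
  qed
  moreover have "subcols (zero_pos \<sigma>) G \<in> carrier_mat d (length (zero_pos \<sigma>))"
    using G by (auto simp: subcols_def)
  ultimately obtain A where "complement_basis_mat (subcols (zero_pos \<sigma>) G) A"
    using complement_basis_mat_exists by blast
  then obtain s' where "process_sign r Q G l u \<sigma> s s'"
    unfolding process_sign_def by (metis ex_in_conv)
  moreover obtain s'' where "process_signs r Q G l u \<sigma>s s' s''"
    using Cons.IH Cons.prems by fastforce
  ultimately show ?case by (blast intro: process_signs.cons)
qed

lemma finite_sign_vecs:
  assumes G: "G \<in> carrier_mat d N"
  shows "finite (sign_vecs G)"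
proof (rule finite_subset)
  show "sign_vecs G \<subseteq> vec_of_list ` {xs. set xs \<subseteq> {-1,0,1} \<and> length xs = N}"
  proof
    fix \<sigma> assume \<sigma>: "\<sigma> \<in> sign_vecs G"
    note D = sign_vecsD[OF \<sigma> G]
    have "set (list_of_vec \<sigma>) \<subseteq> {-1,0,1}"
    proof
      fix a assume "a \<in> set (list_of_vec \<sigma>)"
      then obtain i where "i < N" "a = \<sigma> $ i"
        using D(1) by (auto simp: in_set_conv_nth list_of_vec_index)
      then show "a \<in> {-1,0,1}" using D(2) by blast
    qed
    then show "\<sigma> \<in> vec_of_list ` {xs. set xs \<subseteq> {-1,0,1} \<and> length xs = N}"
      using D(1) by (intro image_eqI[of _ _ "list_of_vec \<sigma>"]) (auto simp: vec_list)
  qed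
qed (simp add: finite_lists_length_eq)

section \<open>Homogenization of the linear term\<close>

lemma homogenize_carrier:
  assumes "Q \<in> carrier_mat n n" "q \<in> carrier_vec n"
  shows "homogenize Q q \<in> carrier_mat (if q = 0\<^sub>v n then n else n + 1) (if q = 0\<^sub>v n then n else n + 1)"
  using assms by (auto simp: homogenize_def Let_def)

lemma homogenize_rational:
  assumes Q: "Q \<in> carrier_mat n n" and q: "q \<in> carrier_vec n"
    and "elements_mat Q \<subseteq> \<rat>" "set\<^sub>v q \<subseteq> \<rat>"
  shows "elements_mat (homogenize Q q) \<subseteq> \<rat>"
proof -
  have "q $ i \<in> \<rat>" if "i < n" for i
    using assms that vec_setI[of q i "q $ i"] by auto
  then have "four_block_mat Q (mat_of_cols n [(1/2) \<cdot>\<^sub>v q]) (mat_of_rows n [(1/2) \<cdot>\<^sub>v q]) (0\<^sub>m 1 1) $$ (i,j) \<in> \<rat>"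
    if "i < n + 1" "j < n + 1" for i j
    using that Q q assms(3)
    by (cases "i < n"; cases "j < n") (auto simp: elements_mat_subset_iff mat_of_cols_def mat_of_rows_def)
  then show ?thesis
    using Q q assms(3) by (cases "q = 0\<^sub>v n") (auto simp: homogenize_def elements_mat_subset_iff)
qed

lemma extend_bound_carrier:
  assumes "q \<in> carrier_vec n" "v \<in> carrier_vec n"
  shows "extend_bound q v \<in> carrier_vec (if q = 0\<^sub>v n then n else n + 1)"
  using assms unfolding extend_bound_def by (auto intro!: carrier_vecI)

text \<open>Both bounds of the additional coordinate are 1, so they force it to be 1.\<close>

lemma box_extend_bound:
  assumes q: "q \<in> carrier_vec n" and l: "l \<in> carrier_vec n" and u: "u \<in> carrier_vec n"
  shows "box (if q = 0\<^sub>v n then n else n + 1) (extend_bound q l) (extend_bound q u) =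
    extend_bound q ` box n l u"
proof (cases "q = 0\<^sub>v n")
  case True
  then show ?thesis using q by (simp add: extend_bound_def)
next
  case False
  define e where "e = vec_of_list [1 :: real]"
  have e: "dim_vec e = 1" "e $ 0 = 1" by (auto simp: e_def)
  have nth: "(v @\<^sub>v e) $ i = (if i < n then v $ i else 1)" if "v \<in> carrier_vec n" "i < n + 1" for v i
  proof -
    have "i - n = 0" using that(2) by simp
    then show ?thesis
      using index_append_vec(1)[of i v e] that(2) e unfolding carrier_vecD[OF that(1)] by simp
  qed
  have box_e: "z \<in> box (n + 1) (l @\<^sub>v e) (u @\<^sub>v e) \<longleftrightarrow> z \<in> carrier_vec (n + 1) \<and>
      (\<forall>i<n. l $ i \<le> z $ i \<and> z $ i \<le> u $ i) \<and> z $ n = 1" for z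
  proof -
    have "z \<in> box (n + 1) (l @\<^sub>v e) (u @\<^sub>v e) \<longleftrightarrow> z \<in> carrier_vec (n + 1) \<and>
        (\<forall>i<n + 1. (l @\<^sub>v e) $ i \<le> z $ i \<and> z $ i \<le> (u @\<^sub>v e) $ i)"
    proof (cases "z \<in> carrier_vec (n + 1)")
      case True
      then show ?thesis
        unfolding box_def less_eq_vec_def mem_Collect_eq index_append_vec(2)
          carrier_vecD[OF l] carrier_vecD[OF u] carrier_vecD[OF True] e(1) by blast
    qed (simp add: box_def)
    also have "\<dots> \<longleftrightarrow> z \<in> carrier_vec (n + 1) \<and>
        (\<forall>i<n + 1. (if i < n then l $ i else 1) \<le> z $ i \<and> z $ i \<le> (if i < n then u $ i else 1))"
      using nth[OF l] nth[OF u] by simp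
    also have "\<dots> \<longleftrightarrow> z \<in> carrier_vec (n + 1) \<and>
        (\<forall>i<n. l $ i \<le> z $ i \<and> z $ i \<le> u $ i) \<and> z $ n = 1"
      unfolding Suc_eq_plus1[symmetric] All_less_Suc by auto
    finally show ?thesis .
  qed
  have "z \<in> box (n + 1) (l @\<^sub>v e) (u @\<^sub>v e) \<longleftrightarrow> (\<exists>x\<in>box n l u. z = x @\<^sub>v e)" for z
  proof
    assume z: "z \<in> box (n + 1) (l @\<^sub>v e) (u @\<^sub>v e)"
    define x where "x = vec n (\<lambda>i. z $ i)"
    have "x \<in> carrier_vec n" by (simp add: x_def)
    moreover have "x \<in> box n l u"
      using z[unfolded box_e] l u by (auto simp: x_def box_def less_eq_vec_def)
    moreover have "z = x @\<^sub>v e"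
    proof (rule eq_vecI)
      fix i assume "i < dim_vec (x @\<^sub>v e)"
      then have i: "i < n + 1" using e by (simp add: x_def)
      show "z $ i = (x @\<^sub>v e) $ i"
        using z[unfolded box_e] i nth[OF \<open>x \<in> carrier_vec n\<close> i]
        by (cases "i < n") (auto simp: x_def not_less dest: le_antisym)
    qed (use z[unfolded box_e] e in \<open>simp add: x_def\<close>)
    ultimately show "\<exists>x\<in>box n l u. z = x @\<^sub>v e" by blast
  next
    assume "\<exists>x\<in>box n l u. z = x @\<^sub>v e"
    then obtain x where x: "x \<in> box n l u" "z = x @\<^sub>v e" by blast
    then have xc: "x \<in> carrier_vec n" by (simp add: box_def)
    show "z \<in> box (n + 1) (l @\<^sub>v e) (u @\<^sub>v e)"
      unfolding box_e using x l u nth[OF xc] xc e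
      by (auto simp: box_def less_eq_vec_def intro!: carrier_vecI)
  qed
  then show ?thesis using False q unfolding extend_bound_def e_def by auto
qed

text \<open>Each of the two borders of the matrix contributes one half of the linear term.\<close>

lemma quadratic_form_homogenize:
  assumes Q: "Q \<in> carrier_mat n n" and q: "q \<in> carrier_vec n" and x: "x \<in> carrier_vec n"
  shows "extend_bound q x \<bullet> (homogenize Q q *\<^sub>v extend_bound q x) = quad_objective Q q x"
proof (cases "q = 0\<^sub>v n")
  case True
  then show ?thesis using x by (simp add: extend_bound_def homogenize_def quad_objective_def)
next
  case False
  define e where "e = vec_of_list [1 :: real]"
  have e: "e \<in> carrier_vec 1" "e $ 0 = 1" by (auto simp: e_def carrier_dim_vec)
  let ?c = "mat_of_cols n [(1/2) \<cdot>\<^sub>v q]" and ?r = "mat_of_rows n [(1/2) \<cdot>\<^sub>v q]"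
  have Qe: "homogenize Q q *\<^sub>v (x @\<^sub>v e) = (Q *\<^sub>v x + ?c *\<^sub>v e) @\<^sub>v (?r *\<^sub>v x + 0\<^sub>m 1 1 *\<^sub>v e)"
    using False Q q x e unfolding homogenize_def Let_def
    by (subst four_block_mat_mult_vec[of _ n n _ 1 _ 1, symmetric]) auto
  have c: "?c *\<^sub>v e = (1/2) \<cdot>\<^sub>v q"
    using q e by (intro eq_vecI) (auto simp: mat_of_cols_def scalar_prod_def)
  have r: "?r *\<^sub>v x + 0\<^sub>m 1 1 *\<^sub>v e = vec 1 (\<lambda>_. (1/2) * (q \<bullet> x))"
    using q x e by (intro eq_vecI) (auto simp: mat_of_rows_def scalar_prod_def sum_divide_distrib)
  have "(x @\<^sub>v e) \<bullet> (homogenize Q q *\<^sub>v (x @\<^sub>v e)) =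
      x \<bullet> (Q *\<^sub>v x + (1/2) \<cdot>\<^sub>v q) + e \<bullet> vec 1 (\<lambda>_. (1/2) * (q \<bullet> x))"
    unfolding Qe c r using Q q x e by (intro scalar_prod_append[of _ n _ 1]) auto
  also have "e \<bullet> vec 1 (\<lambda>_. (1/2) * (q \<bullet> x)) = (1/2) * (q \<bullet> x)"
    using e by (simp add: scalar_prod_def)
  also have "x \<bullet> (Q *\<^sub>v x + (1/2) \<cdot>\<^sub>v q) = x \<bullet> (Q *\<^sub>v x) + (1/2) * (q \<bullet> x)"
    using Q q x comm_scalar_prod[OF x q] by (simp add: scalar_prod_add_distrib[of _ n])
  finally show ?thesis
    using False q by (simp add: extend_bound_def e_def quad_objective_def)
qed

section \<open>Correctness of the algorithm\<close>

theorem theorem2: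
  fixes n :: nat and Q :: "real mat" and q xl xu :: "real vec"
  assumes "Q \<in> carrier_mat n n" "q \<in> carrier_vec n" "xl \<in> carrier_vec n" "xu \<in> carrier_vec n"
    and "elements_mat Q \<subseteq> \<rat>" "set\<^sub>v q \<subseteq> \<rat>" "set\<^sub>v xl \<subseteq> \<rat>" "set\<^sub>v xu \<subseteq> \<rat>"
    and "xl \<le> xu"
  shows "(\<exists>result. algorithm1 Q q xl xu result) \<and>
    (\<forall>fstar xstar. algorithm1 Q q xl xu (fstar, xstar) \<longrightarrow>
       (let xmax = (if q = 0\<^sub>v n then xstar else vec_first xstar n) in
          is_arg_max (quad_objective Q q) (\<lambda>x. x \<in> box n xl xu) xmax \<and>
          fstar = ereal (quad_objective Q q xmax)))"
proof -
  define N where "N = (if q = 0\<^sub>v n then n else n + 1)"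
  define Q' where "Q' = homogenize Q q"
  define l where "l = extend_bound q xl"
  define u where "u = extend_bound q xu"
  define r where "r = vec_space.rank N Q'"
  have Q': "Q' \<in> carrier_mat N N"
    unfolding Q'_def N_def by (rule homogenize_carrier[OF assms(1,2)])
  have l: "l \<in> carrier_vec N" and u: "u \<in> carrier_vec N"
    unfolding l_def u_def N_def
    by (rule extend_bound_carrier[OF assms(2,3)], rule extend_bound_carrier[OF assms(2,4)])
  have box: "box N l u = extend_bound q ` box n xl xu"
    unfolding N_def l_def u_def by (rule box_extend_bound[OF assms(2-4)])
  have "xl \<in> box n xl xu" using assms(3,9) by (simp add: box_def)
  then have "l \<in> box N l u" unfolding box by (simp add: l_def)
  then have lu: "l \<le> u" by (simp add: box_def)
  have alg: "algorithm1 Q q xl xu res \<longleftrightarrow> (\<exists>U V \<sigma>s.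
        U \<in> carrier_mat r N \<and> V \<in> carrier_mat r N \<and> elements_mat U \<subseteq> \<rat> \<and> elements_mat V \<subseteq> \<rat> \<and>
        U\<^sup>T * V = Q' \<and> distinct \<sigma>s \<and> set \<sigma>s = sign_vecs (U @\<^sub>r V) \<and>
        process_signs r Q' (U @\<^sub>r V) l u \<sigma>s (-\<infinity>, 0\<^sub>v (dim_vec q)) res)" for res
    unfolding algorithm1_def Let_def Q'_def[symmetric] l_def[symmetric] u_def[symmetric]
      carrier_matD(1)[OF Q'] r_def ..
  have "\<exists>result. algorithm1 Q q xl xu result"
  proof -
    have "elements_mat Q' \<subseteq> \<rat>"
      unfolding Q'_def by (rule homogenize_rational[OF assms(1,2,5,6)])
    then obtain U V where UV: "U \<in> carrier_mat r N" "V \<in> carrier_mat r N"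
        "elements_mat U \<subseteq> \<rat>" "elements_mat V \<subseteq> \<rat>" "U\<^sup>T * V = Q'"
      using rational_rank_factorization[OF Q'] unfolding r_def by blast
    have G: "U @\<^sub>r V \<in> carrier_mat (r + r) N" using UV by simp
    have "elements_mat (U @\<^sub>r V) \<subseteq> \<rat>"
      using UV(1-4) by (auto simp: elements_mat_subset_iff append_rows_def)
    moreover obtain \<sigma>s where \<sigma>s: "distinct \<sigma>s" "set \<sigma>s = sign_vecs (U @\<^sub>r V)"
      using finite_distinct_list[OF finite_sign_vecs[OF G]] by blast
    ultimately obtain res where
      "process_signs r Q' (U @\<^sub>r V) l u \<sigma>s (-\<infinity>, 0\<^sub>v (dim_vec q)) res"
      using process_signs_exists[OF G] by blast
    then show ?thesis unfolding alg using UV \<sigma>s by blast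
  qed
  moreover have "is_arg_max (quad_objective Q q) (\<lambda>x. x \<in> box n xl xu) xmax \<and>
      fstar = ereal (quad_objective Q q xmax)"
    if run: "algorithm1 Q q xl xu (fstar, xstar)"
      and xmax: "xmax = (if q = 0\<^sub>v n then xstar else vec_first xstar n)" for fstar xstar xmax
  proof -
    obtain U V \<sigma>s where UV: "U \<in> carrier_mat r N" "V \<in> carrier_mat r N" "U\<^sup>T * V = Q'"
      and \<sigma>s: "set \<sigma>s = sign_vecs (U @\<^sub>r V)"
      and run: "process_signs r Q' (U @\<^sub>r V) l u \<sigma>s (-\<infinity>, 0\<^sub>v (dim_vec q)) (fstar, xstar)"
      using run unfolding alg by blast
    note opt = process_signs_maximizes[OF UV(1,2) l u lu UV(3)[symmetric] run \<sigma>s]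
    have obj: "extend_bound q x \<bullet> (Q' *\<^sub>v extend_bound q x) = quad_objective Q q x"
      if "x \<in> box n xl xu" for x
      using quadratic_form_homogenize[OF assms(1,2), of x] that by (simp add: Q'_def box_def)
    obtain x where x: "x \<in> box n xl xu" and xstar: "xstar = extend_bound q x"
      using opt(1) unfolding box by blast
    have "dim_vec x = n" using x by (simp add: box_def)
    then have "xmax = x"
      using assms(2) by (auto simp: xmax xstar extend_bound_def vec_first_def)
    moreover have "quad_objective Q q z \<le> quad_objective Q q x" if "z \<in> box n xl xu" for z
      using opt(3)[of "extend_bound q z"] that obj[OF that] obj[OF x] by (simp add: box xstar)
    ultimately show ?thesis
      using x obj[OF x] opt(2) by (auto simp: is_arg_max_def xstar not_less)
  qed
  ultimately show ?thesis unfolding Let_def by blast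
qed

end
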